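(* For all $d\ge 2$, the set $\mathscr{L}_d$ of isochronous centers is an affine variety over $\mathbb{Q}$ in $\mathbb{C}^{N(d)}$.
   Context: Consider real planar vector fields written in complex form (with $y=\bar x$) as $X=i(x\partial_x-y\partial_y)+P(x,y)\partial_x+Q(x,y)\partial_y$, where $P,Q$ are polynomials of degree at most $d$ with complex coefficients, with only terms of degree between $2$ and $d$, satisfying the reality condition $\overline{P(x,y)}=Q(y,x)$ (i.e. $Q(x,y)=\overline{P}(y,x)$, where $\overline P$ is $P$ with conjugated coefficients). The coefficients of $Q$ are determined by those of $P$, and the pair $(P,Q)$ is identified with the vector $\mathbf{p}\in\mathbb{C}^{N(d)}$ of coefficients of $P$, where $N(d)=\frac{(d-1)(d+4)}{2}$. The set $\mathscr{L}_d\subset\mathbb{C}^{N(d)}$ is the set of those perturbations $(P,Q)$ for which $X$ is linearizable (conjugate to its linear part at the origin); for these real vector fields this is equivalent to the origin being an isochronous center. An affine variety in $\mathbb{C}^{N}$ is the common zero set $\{\mathbf{p}\in\mathbb{C}^N : f_1(\mathbf{p})=\dots=f_s(\mathbf{p})=0\}$ of finitely many polynomials; it is over $\mathbb{Q}$ if the defining polynomials can be taken with rational coefficients.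
   Formalization: "Affine variety over Q in C^{N(d)}" is taken as the zero set of finitely many rational polynomials in the real and imaginary parts of the coefficients of P; with polynomials in the complex coefficients p alone, the claim is false for every d ≥ 2. *)

theory Defs
  imports "HOL-Analysis.Analysis" "HOL-Library.Poly_Mapping"
begin

section \<open>The perturbations\<close>

definition monomials :: "nat \<Rightarrow> (nat \<times> nat) set" where
  "monomials d = {(j, k). 2 \<le> j + k \<and> j + k \<le> d}"

text \<open>
  For a finite index set \<open>I\<close>, the space of complex vectors indexed by \<open>I\<close> is the set of
  functions vanishing outside \<open>I\<close>. A coefficient vector \<open>p\<close> in \<open>cspace (monomials d)\<close> stands
  for the polynomial with coefficient \<open>p (j, k)\<close> at \<open>x ^ j * y ^ k\<close>.
\<close>

definition cspace :: "'i set \<Rightarrow> ('i \<Rightarrow> complex) set" where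
  "cspace I = {p. \<forall>i. i \<notin> I \<longrightarrow> p i = 0}"

definition P_poly :: "nat \<Rightarrow> (nat \<times> nat \<Rightarrow> complex) \<Rightarrow> complex \<Rightarrow> complex \<Rightarrow> complex" where
  "P_poly d p x y = (\<Sum>(j, k)\<in>monomials d. p (j, k) * x ^ j * y ^ k)"

definition Q_poly :: "nat \<Rightarrow> (nat \<times> nat \<Rightarrow> complex) \<Rightarrow> complex \<Rightarrow> complex \<Rightarrow> complex" where
  "Q_poly d p x y = P_poly d (\<lambda>m. cnj (p m)) y x"

definition vfield :: "nat \<Rightarrow> (nat \<times> nat \<Rightarrow> complex) \<Rightarrow> complex \<times> complex \<Rightarrow> complex \<times> complex" where
  "vfield d p = (\<lambda>(x, y). (\<i> * x + P_poly d p x y, - \<i> * y + Q_poly d p x y))"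

text \<open>
  The field is tangent to the real plane \<open>y = cnj x\<close> (lemma \<open>vfield_real\<close> below). Its
  restriction to that plane, read in the coordinate \<open>x\<close>, is the real planar vector field.
\<close>

definition plane_vfield :: "nat \<Rightarrow> (nat \<times> nat \<Rightarrow> complex) \<Rightarrow> complex \<Rightarrow> complex" where
  "plane_vfield d p z = fst (vfield d p (z, cnj z))"

section \<open>Linearizability at the origin\<close>

text \<open>
  Real analyticity of a map of the plane: near \<open>w\<close> it is the sum of an (automatically
  absolutely) convergent power series in \<open>z - w\<close> and its conjugate. As these are linear
  coordinates on the complexified plane, this is the same as a power series in the real and
  imaginary parts of \<open>z - w\<close>.
\<close>

definition real_analytic_at :: "(complex \<Rightarrow> complex) \<Rightarrow> complex \<Rightarrow> bool" where
  "real_analytic_at h w \<longleftrightarrow>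
     (\<exists>a :: nat \<times> nat \<Rightarrow> complex. \<exists>r>0. \<forall>z\<in>ball w r.
        ((\<lambda>(m, n). a (m, n) * (z - w) ^ m * cnj (z - w) ^ n) has_sum h z) UNIV)"

text \<open>
  Derivatives are real derivatives of maps of the plane. The map \<open>h\<close> is a local analytic
  diffeomorphism fixing the origin that carries \<open>V\<close> to its linear part.
\<close>

definition linearizable :: "(complex \<Rightarrow> complex) \<Rightarrow> bool" where
  "linearizable V \<longleftrightarrow>
     (\<exists>h. real_analytic_at h 0 \<and> h 0 = 0 \<and> bij (frechet_derivative h (at 0)) \<and>
        (\<forall>\<^sub>F z in nhds 0.
           frechet_derivative h (at z) (V z) = frechet_derivative V (at 0) (h z)))"

definition isochronous_set :: "nat \<Rightarrow> (nat \<times> nat \<Rightarrow> complex) set" where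
  "isochronous_set d = {p \<in> cspace (monomials d). linearizable (plane_vfield d p)}"

section \<open>Affine varieties over the rationals\<close>

text \<open>A polynomial over \<open>rat\<close> in variables from \<open>'v\<close> maps exponent vectors to coefficients.\<close>

type_synonym 'v rat_mpoly = "('v \<Rightarrow>\<^sub>0 nat) \<Rightarrow>\<^sub>0 rat"

definition mpoly_vars :: "'v rat_mpoly \<Rightarrow> 'v set" where
  "mpoly_vars f = (\<Union>m\<in>Poly_Mapping.keys f. Poly_Mapping.keys m)"

definition mpoly_eval :: "'v rat_mpoly \<Rightarrow> ('v \<Rightarrow> real) \<Rightarrow> real" where
  "mpoly_eval f x =
     (\<Sum>m\<in>Poly_Mapping.keys f. of_rat (Poly_Mapping.lookup f m) * (\<Prod>v\<in>Poly_Mapping.keys m. x v ^ Poly_Mapping.lookup m v))"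

text \<open>
  The reality condition makes the coefficients of \<open>Q\<close> conjugates of those of \<open>P\<close>, so the
  parameter space has to be treated as a real affine space: the polynomials are polynomials in
  the real and imaginary parts of the entries of \<open>p\<close>. With polynomials in the entries of \<open>p\<close>
  alone the set of isochronous centers is not algebraic. For \<open>z' = \<i> z + a z\<^sup>2 + b z (cnj z)\<close>
  it contains every point with \<open>b = cnj a\<close>; these are Zariski dense in the \<open>(a, b)\<close>-plane, but
  the point \<open>a = 0\<close>, \<open>b = 1\<close> is not isochronous.
\<close>

definition real_coords :: "('i \<Rightarrow> complex) \<Rightarrow> 'i + 'i \<Rightarrow> real" where
  "real_coords p = case_sum (\<lambda>i. Re (p i)) (\<lambda>i. Im (p i))"

definition affine_variety_over_rat :: "'i set \<Rightarrow> ('i \<Rightarrow> complex) set \<Rightarrow> bool" where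
  "affine_variety_over_rat I S \<longleftrightarrow>
     (\<exists>F :: ('i + 'i) rat_mpoly set. finite F \<and> (\<forall>f\<in>F. mpoly_vars f \<subseteq> I <+> I) \<and>
        S = {p \<in> cspace I. \<forall>f\<in>F. mpoly_eval f (real_coords p) = 0})"

section \<open>Consistency of the definitions\<close>

lemma finite_monomials: "finite (monomials d)"
  by (rule finite_subset[of _ "{..d} \<times> {..d}"]) (auto simp: monomials_def)

lemma card_monomials:
  assumes "d \<ge> 2"
  shows "card (monomials d) = (d - 1) * (d + 4) div 2"
proof -
  have step: "card (monomials (Suc d)) = card (monomials d) + (d + 2)" if "d \<ge> 1" for d
  proof -
    have "monomials (Suc d) = monomials d \<union> (\<lambda>j. (j, Suc d - j)) ` {..Suc d}"
      using that by (auto simp: monomials_def image_iff)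
    moreover have "monomials d \<inter> (\<lambda>j. (j, Suc d - j)) ` {..Suc d} = {}"
      by (auto simp: monomials_def)
    moreover have "card ((\<lambda>j. (j, Suc d - j)) ` {..Suc d}) = d + 2"
      by (subst card_image) (auto simp: inj_on_def)
    ultimately show ?thesis
      by (simp add: card_Un_disjoint finite_monomials)
  qed
  have "2 * card (monomials (Suc n)) = n * (n + 5)" for n
  proof (induction n)
    case 0
    have "monomials (Suc 0) = {}" by (auto simp: monomials_def)
    then show ?case by simp
  next
    case (Suc n)
    then show ?case using step[of "Suc n"] by (simp add: algebra_simps)
  qed
  from this[of "d - 1"] assms show ?thesis
    by (cases d) (auto simp: add.commute)
qed

lemma cnj_P_poly: "cnj (P_poly d p x y) = P_poly d (\<lambda>m. cnj (p m)) (cnj x) (cnj y)"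
  by (simp add: P_poly_def case_prod_beta)

lemma vfield_real: "vfield d p (z, cnj z) = (plane_vfield d p z, cnj (plane_vfield d p z))"
  by (simp add: plane_vfield_def vfield_def Q_poly_def cnj_P_poly)

lemma P_poly_has_derivative_0:
  "((\<lambda>z. P_poly d p z (cnj z)) has_derivative (\<lambda>_. 0)) (at 0)"
proof -
  have "((\<lambda>z. p (j, k) * z ^ j * cnj z ^ k) has_derivative (\<lambda>_. 0)) (at 0)"
    if "(j, k) \<in> monomials d" for j k
  proof -
    have jk: "2 \<le> j + k" using that by (auto simp: monomials_def)
    have "((\<lambda>z. p (j, k) * z ^ j * cnj z ^ k) has_derivative
        (\<lambda>v. p (j, k) * 0 ^ j * (of_nat k * cnj v * cnj 0 ^ (k - 1)) +
             p (j, k) * (of_nat j * v * 0 ^ (j - 1)) * cnj 0 ^ k)) (at 0)"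
      by (auto intro!: derivative_eq_intros bounded_linear.has_derivative[OF bounded_linear_cnj])
    also have "(\<lambda>v. p (j, k) * 0 ^ j * (of_nat k * cnj v * cnj 0 ^ (k - 1)) +
             p (j, k) * (of_nat j * v * 0 ^ (j - 1)) * cnj 0 ^ k) = (\<lambda>_. 0)"
      using jk by (cases j; cases k) (auto simp: fun_eq_iff power_0_left)
    finally show ?thesis .
  qed
  then have "((\<lambda>z. \<Sum>m\<in>monomials d. p m * z ^ fst m * cnj z ^ snd m) has_derivative
      (\<lambda>_. \<Sum>m\<in>monomials d. 0)) (at 0)"
    by (intro has_derivative_sum) auto
  then show ?thesis
    by (simp add: P_poly_def case_prod_beta)
qed

lemma linear_part_plane_vfield: "frechet_derivative (plane_vfield d p) (at 0) = (\<lambda>v. \<i> * v)"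
proof -
  have "((\<lambda>z. \<i> * z + P_poly d p z (cnj z)) has_derivative (\<lambda>v. \<i> * v + 0)) (at 0)"
    by (intro has_derivative_add P_poly_has_derivative_0) (auto intro!: derivative_eq_intros)
  then have "(plane_vfield d p has_derivative (\<lambda>v. \<i> * v)) (at 0)"
    by (simp add: plane_vfield_def[abs_def] vfield_def)
  then show ?thesis
    by (metis frechet_derivative_at)
qed

end

theory Submission
  imports Defs
    "HOL-Computational_Algebra.Polynomial"
    "HOL-Computational_Algebra.Formal_Power_Series"
    "HOL-Complex_Analysis.Cauchy_Integral_Formula"
begin

text \<open>
  The set of isochronous centers is cut out by a sequence of obstructions, each of which is a
  polynomial with rational coefficients in the real and imaginary parts of the entries of \<open>p\<close>.
  Hilbert's basis theorem (\<open>hilbert_basis\<close>, \<open>noetherian_polys_in\<close>) then replaces the infinite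
  family by a finite one.

  To find the obstructions, write \<open>V\<close> for the field and look for a map \<open>\<phi>(z) = z + \<dots>\<close>, a series in \<open>z\<close> and \<open>cnj z\<close>,
  that carries the rotation \<open>\<i> z\<close> to \<open>V\<close>, that is,
  \<open>D\<phi>(\<i> z) = \<i> \<phi> + P(\<phi>, cnj \<phi>)\<close>. At the monomial \<open>z ^ m * cnj z ^ n\<close> this reads
  \<open>\<i> * (m - n - 1) * \<phi> $ m $ n = S $ m $ n\<close>, where \<open>S\<close> is the series of \<open>P(\<phi>, cnj \<phi>)\<close> and
  \<open>S $ m $ n\<close> depends on coefficients of \<open>\<phi>\<close> of lower degree only. So it can be solved recursively,
  except at the resonances \<open>m = n + 1\<close>. There, beyond the linear term, the coefficient of \<open>\<phi>\<close> is set to 0, and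
  the number \<open>S $ (k + 1) $ k\<close> is the obstruction of index \<open>k\<close>. The recursion is rational, hence so are the
  obstructions (\<open>rational_in_obstruction\<close>). The divisors \<open>m - n - 1\<close> have absolute value at least 1
  and the right-hand side contains no derivative of \<open>\<phi>\<close>, so the series \<open>\<phi>\<close> converges for every \<open>p\<close>, whatever the
  obstructions are (\<open>norm_le_solution\<close>). As a function it satisfies
  \<open>D\<phi>(\<i> z) = V(\<phi>(z)) - z * \<rho>(z * cnj z)\<close>, where \<open>\<rho>\<close> is the power series whose coefficients are the obstructions
  (\<open>normalization_flow\<close>, \<open>resonant_series_eval\<close>).

  If all obstructions vanish, the local inverse of \<open>\<phi>\<close> is a linearization
  (\<open>linearizable_if_no_obstruction\<close>). Conversely, let \<open>h\<close> be a linearization with derivative \<open>c\<close> at 0.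
  The function \<open>cis (- \<theta>) * h (\<phi> (t * cis \<theta>))\<close> of \<open>\<theta>\<close> is periodic, and its
  derivative is approximately the constant \<open>- c * t * \<rho>(t\<^sup>2)\<close>. So \<open>\<rho>(t\<^sup>2) = 0\<close> for all small \<open>t > 0\<close>, and
  all obstructions vanish (\<open>no_obstruction_if_linearizable\<close>).
\<close>

section \<open>Hilbert's basis theorem\<close>

text \<open>
  Ideals of a subring \<open>R\<close> of a fixed ambient ring. Working with subsets of one type lets an
  induction adjoin one variable after the other, which a ring for each number of variables, each
  with its own type, would not.
\<close>

inductive_set ideal_gen :: "'a::comm_ring_1 set \<Rightarrow> 'a set \<Rightarrow> 'a set" for R S where
  zero: "0 \<in> ideal_gen R S"
| base: "s \<in> S \<Longrightarrow> s \<in> ideal_gen R S"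
| add: "x \<in> ideal_gen R S \<Longrightarrow> y \<in> ideal_gen R S \<Longrightarrow> x + y \<in> ideal_gen R S"
| mult: "r \<in> R \<Longrightarrow> x \<in> ideal_gen R S \<Longrightarrow> r * x \<in> ideal_gen R S"

definition is_subring :: "'a::comm_ring_1 set \<Rightarrow> bool" where
  "is_subring R \<longleftrightarrow> 1 \<in> R \<and> (\<forall>x\<in>R. - x \<in> R) \<and> (\<forall>x\<in>R. \<forall>y\<in>R. x + y \<in> R \<and> x * y \<in> R)"

text \<open>
  Generators are taken from the given set itself, so that an infinite system of equations is replaced
  by finitely many of its own members.
\<close>

definition noetherian :: "'a::comm_ring_1 set \<Rightarrow> bool" where
  "noetherian R \<longleftrightarrow> (\<forall>S\<subseteq>R. \<exists>F\<subseteq>S. finite F \<and> S \<subseteq> ideal_gen R F)"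

lemma noetherianE:
  assumes "noetherian R" "S \<subseteq> R"
  obtains F where "F \<subseteq> S" "finite F" "S \<subseteq> ideal_gen R F"
  using assms unfolding noetherian_def by metis

definition poly_over :: "'a::comm_ring_1 set \<Rightarrow> 'a poly set" where
  "poly_over R = {q. \<forall>n. coeff q n \<in> R}"

definition adjoin :: "'a::comm_ring_1 set \<Rightarrow> 'a \<Rightarrow> 'a set" where
  "adjoin R x = (\<lambda>q. poly q x) ` poly_over R"

lemma is_subring_zero: "is_subring R \<Longrightarrow> 0 \<in> R"
  unfolding is_subring_def by (metis add.right_inverse)

lemma is_subring_add: "is_subring R \<Longrightarrow> x \<in> R \<Longrightarrow> y \<in> R \<Longrightarrow> x + y \<in> R"
  and is_subring_mult: "is_subring R \<Longrightarrow> x \<in> R \<Longrightarrow> y \<in> R \<Longrightarrow> x * y \<in> R"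
  and is_subring_uminus: "is_subring R \<Longrightarrow> x \<in> R \<Longrightarrow> - x \<in> R"
  by (auto simp: is_subring_def)

lemma is_subring_sum: "is_subring R \<Longrightarrow> (\<And>i. i \<in> A \<Longrightarrow> f i \<in> R) \<Longrightarrow> sum f A \<in> R"
  by (induction A rule: infinite_finite_induct) (auto simp: is_subring_zero is_subring_def)

lemma is_subring_power: "is_subring R \<Longrightarrow> x \<in> R \<Longrightarrow> x ^ n \<in> R"
  by (induction n) (auto simp: is_subring_def)

lemma ideal_gen_least: "S \<subseteq> ideal_gen R T \<Longrightarrow> ideal_gen R S \<subseteq> ideal_gen R T"
proof
  fix x assume "S \<subseteq> ideal_gen R T" "x \<in> ideal_gen R S"
  from this(2,1) show "x \<in> ideal_gen R T"
    by induction (auto intro: ideal_gen.intros)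
qed

lemma ideal_gen_mono: "S \<subseteq> T \<Longrightarrow> ideal_gen R S \<subseteq> ideal_gen R T"
  by (intro ideal_gen_least) (auto intro: ideal_gen.base)

lemma ideal_gen_uminus: "is_subring R \<Longrightarrow> x \<in> ideal_gen R S \<Longrightarrow> - x \<in> ideal_gen R S"
  using ideal_gen.mult[of "- 1" R x S] by (auto simp: is_subring_def)

lemma ideal_gen_in_subring:
  assumes "is_subring R" "S \<subseteq> R" "x \<in> ideal_gen R S"
  shows "x \<in> R"
  using assms(3) by induction (use assms is_subring_zero[of R] in \<open>auto simp: is_subring_def\<close>)

lemma ideal_gen_finite:
  assumes "x \<in> ideal_gen R S"
  shows "\<exists>F\<subseteq>S. finite F \<and> x \<in> ideal_gen R F"
  using assms
proof induction
  case zero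
  then show ?case by (intro exI[of _ "{}"]) (auto intro: ideal_gen.zero)
next
  case (base s)
  then show ?case by (intro exI[of _ "{s}"]) (auto intro: ideal_gen.base)
next
  case (add x y)
  then obtain F G where "F \<subseteq> S" "finite F" "x \<in> ideal_gen R F"
    and "G \<subseteq> S" "finite G" "y \<in> ideal_gen R G" by blast
  then show ?case
    using ideal_gen_mono[of F "F \<union> G" R] ideal_gen_mono[of G "F \<union> G" R]
    by (intro exI[of _ "F \<union> G"]) (auto intro!: ideal_gen.add)
next
  case (mult r x)
  then show ?case by (blast intro: ideal_gen.mult)
qed

lemma ideal_gen_finite_subset:
  assumes "finite G" "G \<subseteq> ideal_gen R S"
  shows "\<exists>F\<subseteq>S. finite F \<and> G \<subseteq> ideal_gen R F"
proof -
  obtain F where F: "\<And>x. x \<in> G \<Longrightarrow> F x \<subseteq> S \<and> finite (F x) \<and> x \<in> ideal_gen R (F x)"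
    using ideal_gen_finite[of _ R S] assms(2) by (metis subsetD)
  have "x \<in> ideal_gen R (\<Union>(F ` G))" if "x \<in> G" for x
    using F[OF that] ideal_gen_mono[of "F x" "\<Union>(F ` G)" R] that by blast
  then show ?thesis
    using F assms(1) by (intro exI[of _ "\<Union>(F ` G)"]) auto
qed

lemma is_subring_poly_over:
  assumes "is_subring R"
  shows "is_subring (poly_over R)"
  using is_subring_zero[OF assms] assms
  by (auto simp: is_subring_def poly_over_def coeff_mult coeff_1 intro!: is_subring_sum[OF assms])

lemma monom_in_poly_over: "is_subring R \<Longrightarrow> c \<in> R \<Longrightarrow> monom c n \<in> poly_over R"
  using is_subring_zero[of R] by (auto simp: poly_over_def)

text \<open>
  If \<open>b\<close> is a combination of the leading coefficients of polynomials of degree at most \<open>D\<close>, then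
  the same combination of these polynomials, each multiplied by the power of the variable that lifts
  it to degree \<open>D\<close>, has \<open>b\<close> in degree \<open>D\<close>. This is what reduces the degree in Hilbert's basis theorem.
\<close>

lemma cancel_leading_coeff:
  assumes R: "is_subring R" and deg: "\<And>q. q \<in> G \<Longrightarrow> degree q \<le> D"
    and b: "b \<in> ideal_gen R (lead_coeff ` G)"
  shows "\<exists>q\<in>ideal_gen (poly_over R) G. degree q \<le> D \<and> coeff q D = b"
  using b
proof induction
  case zero
  then show ?case by (intro bexI[of _ 0] ideal_gen.zero) auto
next
  case (base s)
  then obtain q where q: "q \<in> G" "s = lead_coeff q" by blast
  let ?q = "monom 1 (D - degree q) * q"
  have "?q \<in> ideal_gen (poly_over R) G"
    using R q by (intro ideal_gen.mult ideal_gen.base monom_in_poly_over) (auto simp: is_subring_def)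
  moreover have "degree ?q \<le> D"
    using deg[OF q(1)] degree_mult_le[of "monom 1 (D - degree q)" q]
      degree_monom_le[of "1::'a" "D - degree q"] by linarith
  moreover have "coeff ?q D = s"
    using deg[OF q(1)] q(2) by (simp add: coeff_monom_mult)
  ultimately show ?case by blast
next
  case (add x y)
  then obtain p q where "p \<in> ideal_gen (poly_over R) G" "degree p \<le> D" "coeff p D = x"
    "q \<in> ideal_gen (poly_over R) G" "degree q \<le> D" "coeff q D = y" by blast
  then show ?case
    by (intro bexI[of _ "p + q"]) (auto intro: ideal_gen.add degree_add_le)
next
  case (mult r x)
  then obtain p where p: "p \<in> ideal_gen (poly_over R) G" "degree p \<le> D" "coeff p D = x" by blast
  have "monom r 0 * p \<in> ideal_gen (poly_over R) G"
    using p(1) mult(1) R by (intro ideal_gen.mult monom_in_poly_over)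
  then show ?case
    using p degree_smult_le[of r p] by (intro bexI[of _ "smult r p"]) (auto simp: monom_0)
qed

text \<open>
  If no finite subset of \<open>S\<close> generates, one can choose polynomials \<open>g n\<close> in the ideal of \<open>S\<close>, each
  of minimal degree outside the ideal of its predecessors. Their degrees increase weakly. Since
  \<open>R\<close> is noetherian, some leading coefficient is a combination of earlier ones; cancelling
  it contradicts minimality.
\<close>

theorem hilbert_basis:
  assumes R: "is_subring R" and noeth: "noetherian R"
  shows "noetherian (poly_over R)"
proof (rule ccontr)
  let ?I = "ideal_gen (poly_over R)"
  have P: "is_subring (poly_over R)" by (rule is_subring_poly_over[OF R])
  assume "\<not> noetherian (poly_over R)"
  then obtain S where S: "S \<subseteq> poly_over R" "\<And>F. F \<subseteq> S \<Longrightarrow> finite F \<Longrightarrow> \<not> S \<subseteq> ?I F"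
    unfolding noetherian_def by blast
  have ex: "\<exists>q. q \<in> ?I S \<and> q \<notin> ?I G" if "finite G" "G \<subseteq> ?I S" for G
  proof (rule ccontr)
    assume "\<not> ?thesis"
    then have "?I S \<subseteq> ?I G" by blast
    moreover obtain F where F: "F \<subseteq> S" "finite F" "G \<subseteq> ?I F"
      using ideal_gen_finite_subset[OF \<open>finite G\<close> \<open>G \<subseteq> ?I S\<close>] by auto
    ultimately have "?I S \<subseteq> ?I F" using ideal_gen_least[of G "poly_over R" F] by blast
    then have "S \<subseteq> ?I F" by (auto intro: ideal_gen.base)
    then show False using S(2) F by blast
  qed
  define minimal where "minimal G q \<longleftrightarrow> q \<in> ?I S \<and> q \<notin> ?I G \<and>
      (\<forall>q'. q' \<in> ?I S \<and> q' \<notin> ?I G \<longrightarrow> degree q \<le> degree q')" for G q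
  have "\<exists>g :: nat \<Rightarrow> 'a poly. \<forall>n. minimal (g ` {..<n}) (g n)"
  proof (rule dependent_wellorder_choice)
    fix r and f g :: "nat \<Rightarrow> 'a poly" and n :: nat
    assume "\<And>y. y < n \<Longrightarrow> f y = g y"
    then have "f ` {..<n} = g ` {..<n}" by auto
    then show "minimal (f ` {..<n}) r = minimal (g ` {..<n}) r" by simp
  next
    fix n :: nat and f :: "nat \<Rightarrow> 'a poly"
    assume "\<And>y. y < n \<Longrightarrow> minimal (f ` {..<y}) (f y)"
    then have "f ` {..<n} \<subseteq> ?I S" by (auto simp: minimal_def)
    then have "\<exists>q. q \<in> ?I S \<and> q \<notin> ?I (f ` {..<n})" by (intro ex) auto
    then obtain q where "q \<in> ?I S \<and> q \<notin> ?I (f ` {..<n})" by blast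
    from ex_has_least_nat[of "\<lambda>q. q \<in> ?I S \<and> q \<notin> ?I (f ` {..<n})", OF this, of degree]
    show "\<exists>r. minimal (f ` {..<n}) r" unfolding minimal_def by blast
  qed
  then obtain g :: "nat \<Rightarrow> 'a poly" where g: "\<And>n. minimal (g ` {..<n}) (g n)" by blast
  have gS: "g n \<in> ?I S" and gI: "g n \<notin> ?I (g ` {..<n})" for n
    using g[of n] by (auto simp: minimal_def)
  have deg_mono: "degree (g m) \<le> degree (g n)" if "m \<le> n" for m n
  proof -
    have "?I (g ` {..<m}) \<subseteq> ?I (g ` {..<n})" using that by (intro ideal_gen_mono) auto
    then show ?thesis using g[of m] gS[of n] gI[of n] by (auto simp: minimal_def)
  qed
  define a where "a n = lead_coeff (g n)" for n
  have "g n \<in> poly_over R" for n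
    using ideal_gen_in_subring[OF P S(1) gS] .
  then have "range a \<subseteq> R" by (auto simp: a_def poly_over_def)
  then obtain F where F: "F \<subseteq> range a" "finite F" "range a \<subseteq> ideal_gen R F"
    by (rule noetherianE[OF noeth])
  obtain M where M: "finite M" "F = a ` M"
    using finite_subset_image[OF F(2,1)] by blast
  obtain N where N: "M \<subseteq> {..<N}"
    using finite_nat_iff_bounded M(1) by blast
  let ?D = "degree (g N)"
  have "F \<subseteq> a ` {..<N}" using M(2) N by blast
  then have "a N \<in> ideal_gen R (a ` {..<N})"
    using F(3) ideal_gen_mono[of F "a ` {..<N}" R] by blast
  moreover have "a ` {..<N} = lead_coeff ` (g ` {..<N})" by (auto simp: a_def)
  ultimately obtain q where q: "q \<in> ?I (g ` {..<N})" "degree q \<le> ?D" "coeff q ?D = a N"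
    using cancel_leading_coeff[OF R, of "g ` {..<N}" ?D "a N"] deg_mono by fastforce
  have "g ` {..<N} \<subseteq> ?I S" using gS by blast
  from ideal_gen_least[OF this] q(1) have "q \<in> ?I S" by blast
  have qS: "g N - q \<in> ?I S"
    using ideal_gen.add[OF gS ideal_gen_uminus[OF P \<open>q \<in> ?I S\<close>]] by simp
  have nI: "g N - q \<notin> ?I (g ` {..<N})"
    using ideal_gen.add[OF _ q(1), of "g N - q"] gI[of N] by auto
  have "g N - q \<noteq> 0" using nI ideal_gen.zero by metis
  moreover have "coeff (g N - q) ?D = 0" using q(3) by (simp add: a_def)
  moreover have "degree (g N - q) \<le> ?D" using q(2) by (simp add: degree_diff_le)
  ultimately have "degree (g N - q) < ?D"
    using leading_coeff_0_iff le_neq_implies_less by metis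
  then show False using g[of N] qS nI unfolding minimal_def by (meson not_le)
qed

lemma is_subring_adjoin:
  assumes "is_subring R"
  shows "is_subring (adjoin R x)"
proof -
  note P = is_subring_poly_over[OF assms]
  have "1 \<in> adjoin R x"
    using P by (auto simp: adjoin_def is_subring_def intro!: image_eqI[of _ _ 1])
  moreover have "- poly q x \<in> adjoin R x" if "q \<in> poly_over R" for q
    unfolding adjoin_def using P that
    by (intro image_eqI[of _ _ "- q"]) (auto simp: is_subring_def)
  moreover have "poly p x + poly q x \<in> adjoin R x" if "p \<in> poly_over R" "q \<in> poly_over R" for p q
    unfolding adjoin_def using P that
    by (intro image_eqI[of _ _ "p + q"]) (auto simp: is_subring_def)
  moreover have "poly p x * poly q x \<in> adjoin R x" if "p \<in> poly_over R" "q \<in> poly_over R" for p q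
    unfolding adjoin_def using P that
    by (intro image_eqI[of _ _ "p * q"]) (auto simp: is_subring_def)
  ultimately show ?thesis
    unfolding is_subring_def by (auto simp: adjoin_def)
qed

lemma subset_adjoin: "is_subring R \<Longrightarrow> R \<subseteq> adjoin R x"
  using monom_in_poly_over[of R _ 0] by (force simp: adjoin_def monom_0)

lemma in_adjoin: "is_subring R \<Longrightarrow> x \<in> adjoin R x"
  using monom_in_poly_over[of R 1 1]
  by (auto simp: adjoin_def is_subring_def poly_monom intro!: image_eqI[of _ _ "monom 1 1"])

text \<open>
  The ring \<open>R[x]\<close> is the image of the polynomials over \<open>R\<close> under evaluation at \<open>x\<close>, and
  images of noetherian rings are noetherian.
\<close>

lemma noetherian_adjoin:
  assumes "is_subring R" "noetherian R"
  shows "noetherian (adjoin R x)"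
  unfolding noetherian_def
proof (intro allI impI)
  fix S assume S: "S \<subseteq> adjoin R x"
  define T where "T = {q \<in> poly_over R. poly q x \<in> S}"
  have hom: "poly q x \<in> ideal_gen (adjoin R x) ((\<lambda>q. poly q x) ` F)"
    if "q \<in> ideal_gen (poly_over R) F" for q F
    using that by induction (auto intro: ideal_gen.intros simp: adjoin_def)
  have "T \<subseteq> poly_over R" by (auto simp: T_def)
  then obtain F where F: "F \<subseteq> T" "finite F" "T \<subseteq> ideal_gen (poly_over R) F"
    by (rule noetherianE[OF hilbert_basis[OF assms]])
  have "S \<subseteq> ideal_gen (adjoin R x) ((\<lambda>q. poly q x) ` F)"
  proof
    fix s assume "s \<in> S"
    then obtain q where "q \<in> T" "s = poly q x" using S by (auto simp: T_def adjoin_def)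
    then show "s \<in> ideal_gen (adjoin R x) ((\<lambda>q. poly q x) ` F)" using F(3) hom by blast
  qed
  then show "\<exists>F\<subseteq>S. finite F \<and> S \<subseteq> ideal_gen (adjoin R x) F"
    using F(1,2) by (intro exI[of _ "(\<lambda>q. poly q x) ` F"]) (auto simp: T_def)
qed

section \<open>Rational polynomials in finitely many variables\<close>

definition polys_in :: "'v set \<Rightarrow> 'v rat_mpoly set" where
  "polys_in V = {f. mpoly_vars f \<subseteq> V}"

definition mpoly_var :: "'v \<Rightarrow> 'v rat_mpoly" where
  "mpoly_var v = Poly_Mapping.single (Poly_Mapping.single v 1) 1"

lemma polys_in_iff: "f \<in> polys_in V \<longleftrightarrow> (\<forall>m\<in>Poly_Mapping.keys f. Poly_Mapping.keys m \<subseteq> V)"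
  by (auto simp: polys_in_def mpoly_vars_def)

lemma single_in_polys_in:
  "Poly_Mapping.keys m \<subseteq> V \<Longrightarrow> Poly_Mapping.single m c \<in> polys_in V"
  by (auto simp: polys_in_iff split: if_splits)

lemma mpoly_var_in: "v \<in> V \<Longrightarrow> mpoly_var v \<in> polys_in V"
  by (auto simp: mpoly_var_def intro!: single_in_polys_in split: if_splits)

lemma is_subring_polys_in: "is_subring (polys_in V)"
proof -
  have "f * g \<in> polys_in V" if "f \<in> polys_in V" "g \<in> polys_in V" for f g
    unfolding polys_in_iff
  proof
    fix m assume "m \<in> Poly_Mapping.keys (f * g)"
    then obtain k l where "k \<in> Poly_Mapping.keys f" "l \<in> Poly_Mapping.keys g" "m = k + l"
      using keys_mult[of f g] by blast
    then show "Poly_Mapping.keys m \<subseteq> V"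
      using that Poly_Mapping.keys_add[of k l] by (fastforce simp: polys_in_iff)
  qed
  moreover have "f + g \<in> polys_in V" if "f \<in> polys_in V" "g \<in> polys_in V" for f g
    using that Poly_Mapping.keys_add[of f g] by (fastforce simp: polys_in_iff)
  moreover have "- f \<in> polys_in V" if "f \<in> polys_in V" for f
    using that by (auto simp: polys_in_iff)
  moreover have "1 \<in> polys_in V"
    by (auto simp: polys_in_iff)
  ultimately show ?thesis by (auto simp: is_subring_def)
qed

lemma sum_singles: "f = (\<Sum>m\<in>Poly_Mapping.keys f. Poly_Mapping.single m (Poly_Mapping.lookup f m))"
  by (rule poly_mapping_eqI)
    (auto simp: lookup_sum lookup_single when_def in_keys_iff sum.delta cong: if_cong)

definition monomial_eval :: "('v \<Rightarrow>\<^sub>0 nat) \<Rightarrow> ('v \<Rightarrow> real) \<Rightarrow> real" where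
  "monomial_eval m x = (\<Prod>v\<in>Poly_Mapping.keys m. x v ^ Poly_Mapping.lookup m v)"

lemma monomial_eval_superset:
  assumes "finite A" "Poly_Mapping.keys m \<subseteq> A"
  shows "monomial_eval m x = (\<Prod>v\<in>A. x v ^ Poly_Mapping.lookup m v)"
  unfolding monomial_eval_def using assms
  by (intro prod.mono_neutral_left) (auto simp: in_keys_iff)

lemma monomial_eval_add: "monomial_eval (k + l) x = monomial_eval k x * monomial_eval l x"
proof -
  let ?A = "Poly_Mapping.keys k \<union> Poly_Mapping.keys l"
  have "Poly_Mapping.keys (k + l) \<subseteq> ?A" by (rule Poly_Mapping.keys_add)
  then show ?thesis
    by (simp add: monomial_eval_superset[of ?A] lookup_add power_add prod.distrib)
qed

lemma mpoly_eval_superset: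
  assumes "finite A" "Poly_Mapping.keys f \<subseteq> A"
  shows "mpoly_eval f x = (\<Sum>m\<in>A. of_rat (Poly_Mapping.lookup f m) * monomial_eval m x)"
  unfolding mpoly_eval_def monomial_eval_def using assms
  by (intro sum.mono_neutral_left) (auto simp: in_keys_iff)

lemma mpoly_eval_add: "mpoly_eval (f + g) x = mpoly_eval f x + mpoly_eval g x"
proof -
  let ?A = "Poly_Mapping.keys f \<union> Poly_Mapping.keys g"
  have "Poly_Mapping.keys (f + g) \<subseteq> ?A" by (rule Poly_Mapping.keys_add)
  then show ?thesis
    by (simp add: mpoly_eval_superset[of ?A] lookup_add of_rat_add distrib_right sum.distrib)
qed

lemma mpoly_eval_zero [simp]: "mpoly_eval 0 x = 0"
  by (simp add: mpoly_eval_def)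

lemma mpoly_eval_sum: "mpoly_eval (sum f A) x = (\<Sum>a\<in>A. mpoly_eval (f a) x)"
  by (induction A rule: infinite_finite_induct) (auto simp: mpoly_eval_add)

lemma mpoly_eval_single: "mpoly_eval (Poly_Mapping.single m c) x = of_rat c * monomial_eval m x"
  by (subst mpoly_eval_superset[of "{m}"]) auto

lemma mpoly_eval_mult: "mpoly_eval (f * g) x = mpoly_eval f x * mpoly_eval g x"
proof -
  have "f * g = (\<Sum>k\<in>Poly_Mapping.keys f. \<Sum>l\<in>Poly_Mapping.keys g.
      Poly_Mapping.single (k + l) (Poly_Mapping.lookup f k * Poly_Mapping.lookup g l))"
    by (subst (1) sum_singles[of f], subst (1) sum_singles[of g])
      (simp add: sum_product mult_single)
  then have "mpoly_eval (f * g) x = (\<Sum>k\<in>Poly_Mapping.keys f. \<Sum>l\<in>Poly_Mapping.keys g.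
      (of_rat (Poly_Mapping.lookup f k) * monomial_eval k x) *
      (of_rat (Poly_Mapping.lookup g l) * monomial_eval l x))"
    by (simp add: mpoly_eval_sum mpoly_eval_single monomial_eval_add of_rat_mult mult_ac)
  also have "\<dots> = mpoly_eval f x * mpoly_eval g x"
    by (simp add: sum_product mpoly_eval_def monomial_eval_def)
  finally show ?thesis .
qed

lemma mpoly_eval_uminus: "mpoly_eval (- f) x = - mpoly_eval f x"
  using mpoly_eval_add[of f "- f" x] by simp

lemma mpoly_eval_var: "mpoly_eval (mpoly_var v) x = x v"
  by (simp add: mpoly_var_def mpoly_eval_single monomial_eval_def)

lemma mpoly_var_power: "mpoly_var v ^ k = Poly_Mapping.single (Poly_Mapping.single v k) 1"
  by (induction k) (auto simp: mpoly_var_def mult_single simp flip: single_add)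

text \<open>
  A monomial splits into its power of \<open>v\<close> and a monomial in the other variables.
\<close>

lemma polys_in_insert_subset: "polys_in (insert v V) \<subseteq> adjoin (polys_in V) (mpoly_var v)"
proof
  fix f assume f: "f \<in> polys_in (insert v V)"
  let ?A = "adjoin (polys_in V) (mpoly_var v)"
  have A: "is_subring ?A" by (intro is_subring_adjoin is_subring_polys_in)
  have "Poly_Mapping.single m c \<in> ?A" if m: "Poly_Mapping.keys m \<subseteq> insert v V" for m and c :: rat
  proof -
    define k where "k = m - Poly_Mapping.single v (Poly_Mapping.lookup m v)"
    have lk: "Poly_Mapping.lookup k w = (if w = v then 0 else Poly_Mapping.lookup m w)" for w
      by (auto simp: k_def lookup_minus lookup_single)
    have "m = k + Poly_Mapping.single v (Poly_Mapping.lookup m v)"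
      by (rule poly_mapping_eqI) (auto simp: lk lookup_add lookup_single when_def)
    then have "Poly_Mapping.single m c =
        Poly_Mapping.single k c * mpoly_var v ^ Poly_Mapping.lookup m v"
      by (simp add: mpoly_var_power mult_single)
    moreover have "Poly_Mapping.keys k \<subseteq> V"
    proof
      fix w assume "w \<in> Poly_Mapping.keys k"
      then have "w \<noteq> v" "w \<in> Poly_Mapping.keys m" by (auto simp: in_keys_iff lk split: if_splits)
      then show "w \<in> V" using m by auto
    qed
    then have "Poly_Mapping.single k c \<in> ?A"
      using single_in_polys_in subset_adjoin[OF is_subring_polys_in] by blast
    moreover have "mpoly_var v ^ Poly_Mapping.lookup m v \<in> ?A"
      by (intro is_subring_power A in_adjoin is_subring_polys_in)
    ultimately show ?thesis using A by (auto simp: is_subring_def)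
  qed
  then show "f \<in> ?A"
    using f by (subst sum_singles, intro is_subring_sum A) (auto simp: polys_in_iff)
qed

lemma adjoin_subset:
  assumes "is_subring R'" "R \<subseteq> R'" "x \<in> R'"
  shows "adjoin R x \<subseteq> R'"
proof
  fix y assume "y \<in> adjoin R x"
  then obtain q where q: "q \<in> poly_over R" "y = poly q x" by (auto simp: adjoin_def)
  have "coeff q i * x ^ i \<in> R'" for i
    using q(1) assms(2)
    by (intro is_subring_mult is_subring_power assms(1,3)) (auto simp: poly_over_def)
  then show "y \<in> R'"
    unfolding q(2) poly_altdef by (intro is_subring_sum assms(1))
qed

text \<open>
  Without variables the ring is the field of rational constants, so any nonzero element generates.
\<close>

lemma noetherian_polys_in_empty: "noetherian (polys_in {} :: 'v rat_mpoly set)"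
  unfolding noetherian_def
proof (intro allI impI)
  fix S :: "'v rat_mpoly set" assume S: "S \<subseteq> polys_in {}"
  have const: "\<exists>c. f = Poly_Mapping.single 0 c" if "f \<in> S" for f
  proof -
    have "f = (\<Sum>m\<in>Poly_Mapping.keys f. Poly_Mapping.single m (Poly_Mapping.lookup f m))"
      by (rule sum_singles)
    also have "Poly_Mapping.keys f \<subseteq> {0}"
      using that S by (auto simp: polys_in_iff)
    then have "(\<Sum>m\<in>Poly_Mapping.keys f. Poly_Mapping.single m (Poly_Mapping.lookup f m)) =
        (\<Sum>m\<in>{0}. Poly_Mapping.single m (Poly_Mapping.lookup f m))"
      by (intro sum.mono_neutral_left) (auto simp: in_keys_iff)
    finally show ?thesis by auto
  qed
  show "\<exists>F\<subseteq>S. finite F \<and> S \<subseteq> ideal_gen (polys_in {}) F"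
  proof (cases "S \<subseteq> {0}")
    case True
    then show ?thesis by (intro exI[of _ "{}"]) (auto intro: ideal_gen.zero)
  next
    case False
    then obtain s where s: "s \<in> S" "s \<noteq> 0" by blast
    obtain c where c: "s = Poly_Mapping.single 0 c" "c \<noteq> 0" using const[OF s(1)] s(2)
      by (metis single_zero)
    have "t \<in> ideal_gen (polys_in {}) {s}" if t: "t \<in> S" for t
    proof -
      obtain b where "t = Poly_Mapping.single 0 b" using const[OF t] by blast
      then have "t = Poly_Mapping.single 0 (b / c) * s" using c by (simp add: mult_single)
      then show ?thesis
        by (metis ideal_gen.mult ideal_gen.base singletonI single_in_polys_in keys_zero empty_subsetI)
    qed
    then show ?thesis using s(1) by (intro exI[of _ "{s}"]) auto
  qed
qed

lemma noetherian_polys_in: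
  assumes "finite V"
  shows "noetherian (polys_in V)"
  using assms
proof induction
  case empty
  show ?case by (rule noetherian_polys_in_empty)
next
  case (insert v V)
  have "polys_in V \<subseteq> polys_in (insert v V)" by (auto simp: polys_in_def)
  then have "adjoin (polys_in V) (mpoly_var v) = polys_in (insert v V)"
    by (intro subset_antisym adjoin_subset is_subring_polys_in mpoly_var_in
        polys_in_insert_subset) auto
  then show ?case using noetherian_adjoin[OF is_subring_polys_in insert.IH] by metis
qed

lemma mpoly_eval_ideal_gen_eq_0:
  assumes "f \<in> ideal_gen R F" "\<And>g. g \<in> F \<Longrightarrow> mpoly_eval g x = 0"
  shows "mpoly_eval f x = 0"
  using assms(1) by induction (auto simp: assms(2) mpoly_eval_add mpoly_eval_mult)

lemma affine_variety_over_rat_infinite: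
  assumes "finite I" "F \<subseteq> polys_in (I <+> I)"
  shows "affine_variety_over_rat I {p \<in> cspace I. \<forall>f\<in>F. mpoly_eval f (real_coords p) = 0}"
proof -
  have "noetherian (polys_in (I <+> I))" using assms(1) by (intro noetherian_polys_in) auto
  then obtain G where G: "G \<subseteq> F" "finite G" "F \<subseteq> ideal_gen (polys_in (I <+> I)) G"
    using assms(2) by (rule noetherianE)
  have "(\<forall>f\<in>F. mpoly_eval f x = 0) \<longleftrightarrow> (\<forall>f\<in>G. mpoly_eval f x = 0)" for x
    using G(1,3) mpoly_eval_ideal_gen_eq_0[of _ "polys_in (I <+> I)" G x] by (meson subsetD)
  moreover have "\<forall>f\<in>G. mpoly_vars f \<subseteq> I <+> I"
    using G(1) assms(2) by (auto simp: polys_in_def)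
  ultimately show ?thesis
    unfolding affine_variety_over_rat_def using G(2) by (intro exI[of _ G]) simp
qed

text \<open>
  The functions of a complex vector whose real and imaginary parts are rational polynomials in the real
  and imaginary parts of its entries. They form a ring closed under conjugation, which makes them
  convenient for recursions in complex coefficients.
\<close>

definition rational_in :: "'i set \<Rightarrow> (('i \<Rightarrow> complex) \<Rightarrow> complex) \<Rightarrow> bool" where
  "rational_in I g \<longleftrightarrow> (\<exists>f1\<in>polys_in (I <+> I). \<exists>f2\<in>polys_in (I <+> I).
     \<forall>p. g p = Complex (mpoly_eval f1 (real_coords p)) (mpoly_eval f2 (real_coords p)))"

lemma rational_inI:
  assumes "a \<in> polys_in (I <+> I)" "b \<in> polys_in (I <+> I)"
    and "\<And>p. f p = Complex (mpoly_eval a (real_coords p)) (mpoly_eval b (real_coords p))"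
  shows "rational_in I f"
  using assms unfolding rational_in_def by blast

lemma rational_in_add:
  assumes "rational_in I f" "rational_in I g"
  shows "rational_in I (\<lambda>p. f p + g p)"
proof -
  obtain a b c e where *: "a \<in> polys_in (I <+> I)" "b \<in> polys_in (I <+> I)"
      "c \<in> polys_in (I <+> I)" "e \<in> polys_in (I <+> I)"
      "\<And>p. f p = Complex (mpoly_eval a (real_coords p)) (mpoly_eval b (real_coords p))"
      "\<And>p. g p = Complex (mpoly_eval c (real_coords p)) (mpoly_eval e (real_coords p))"
    using assms unfolding rational_in_def by auto
  show ?thesis
    by (intro rational_inI[of "a + c" _ "b + e"] is_subring_add is_subring_polys_in *(1-4))
      (simp add: *(5,6) mpoly_eval_add complex_eq_iff)
qed

lemma rational_in_mult:
  assumes "rational_in I f" "rational_in I g"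
  shows "rational_in I (\<lambda>p. f p * g p)"
proof -
  obtain a b c e where *: "a \<in> polys_in (I <+> I)" "b \<in> polys_in (I <+> I)"
      "c \<in> polys_in (I <+> I)" "e \<in> polys_in (I <+> I)"
      "\<And>p. f p = Complex (mpoly_eval a (real_coords p)) (mpoly_eval b (real_coords p))"
      "\<And>p. g p = Complex (mpoly_eval c (real_coords p)) (mpoly_eval e (real_coords p))"
    using assms unfolding rational_in_def by auto
  show ?thesis
    by (intro rational_inI[of "a * c + (- b) * e" _ "a * e + b * c"]
          is_subring_add is_subring_mult is_subring_uminus is_subring_polys_in *(1-4))
      (simp only: *(5,6) mpoly_eval_add mpoly_eval_mult mpoly_eval_uminus, simp add: complex_eq_iff)
qed

lemma rational_in_cnj:
  assumes "rational_in I f"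
  shows "rational_in I (\<lambda>p. cnj (f p))"
proof -
  obtain a b where *: "a \<in> polys_in (I <+> I)" "b \<in> polys_in (I <+> I)"
      "\<And>p. f p = Complex (mpoly_eval a (real_coords p)) (mpoly_eval b (real_coords p))"
    using assms unfolding rational_in_def by auto
  show ?thesis
    by (intro rational_inI[of a _ "- b"] is_subring_uminus is_subring_polys_in *(1,2))
      (simp add: *(3) mpoly_eval_uminus complex_eq_iff)
qed

lemma rational_in_const: "rational_in I (\<lambda>p. Complex (of_rat a) (of_rat b))"
  by (intro rational_inI[of "Poly_Mapping.single 0 a" _ "Poly_Mapping.single 0 b"])
    (auto simp: mpoly_eval_single monomial_eval_def intro!: single_in_polys_in)

lemma rational_in_coord: "i \<in> I \<Longrightarrow> rational_in I (\<lambda>p. p i)"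
  by (intro rational_inI[of "mpoly_var (Inl i)" _ "mpoly_var (Inr i)"] mpoly_var_in)
    (auto simp: mpoly_eval_var real_coords_def)

lemma rational_in_zero: "rational_in I (\<lambda>p. 0)"
  using rational_in_const[of I 0 0] by (simp add: Complex_eq)

lemma rational_in_sum: "(\<And>a. a \<in> A \<Longrightarrow> rational_in I (f a)) \<Longrightarrow> rational_in I (\<lambda>p. \<Sum>a\<in>A. f a p)"
  by (induction A rule: infinite_finite_induct) (auto intro: rational_in_add rational_in_zero)

lemma affine_variety_of_rational_equations:
  assumes "finite I" "\<And>k. rational_in I (R k)"
  shows "affine_variety_over_rat I {p \<in> cspace I. \<forall>k. R k p = 0}"
proof -
  obtain f g where fg: "\<And>k. f k \<in> polys_in (I <+> I)" "\<And>k. g k \<in> polys_in (I <+> I)"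
    "\<And>k p. R k p = Complex (mpoly_eval (f k) (real_coords p)) (mpoly_eval (g k) (real_coords p))"
    using assms(2) unfolding rational_in_def by metis
  have "(\<forall>k. R k p = 0) \<longleftrightarrow> (\<forall>h\<in>range f \<union> range g. mpoly_eval h (real_coords p) = 0)" for p
    by (auto simp: fg(3) complex_eq_iff)
  moreover have "range f \<union> range g \<subseteq> polys_in (I <+> I)" using fg(1,2) by auto
  from affine_variety_over_rat_infinite[OF assms(1) this]
  have "affine_variety_over_rat I
      {p \<in> cspace I. \<forall>h\<in>range f \<union> range g. mpoly_eval h (real_coords p) = 0}" .
  ultimately show ?thesis by simp
qed

section \<open>Formal power series in a variable and its conjugate\<close>

unbundle no vec_syntax
unbundle fps_syntax
no_notation Infinite_Set_Sum.abs_summable_on (infix \<open>abs'_summable'_on\<close> 50)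

text \<open>
  The coefficient \<open>a $ m $ n\<close> stands at \<open>z ^ m * cnj z ^ n\<close>, with \<open>z\<close> and \<open>cnj z\<close> treated as independent
  variables. Nesting one-variable power series provides the ring structure.
\<close>

type_synonym series = "complex fps fps"

lemma series_mult_nth: "(a * b :: series) $ m $ n = (\<Sum>i\<le>m. \<Sum>j\<le>n. a $ i $ j * b $ (m - i) $ (n - j))"
  by (simp add: fps_mult_nth fps_sum_nth atLeast0AtMost)

lemma series_eqI: "(\<And>m n. a $ m $ n = b $ m $ n) \<Longrightarrow> a = (b :: series)"
  by (intro fps_ext)

lemma series_one_nth: "(1 :: series) $ m $ n = (if m = 0 \<and> n = 0 then 1 else 0)"
  by (simp add: fps_one_nth)

lemma series_X_nth: "(fps_X :: series) $ m $ n = (if m = 1 \<and> n = 0 then 1 else 0)"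
  by (simp add: fps_X_nth)

definition mk_series :: "(nat \<Rightarrow> nat \<Rightarrow> complex) \<Rightarrow> series" where
  "mk_series c = Abs_fps (\<lambda>m. Abs_fps (c m))"

lemma mk_series_nth [simp]: "mk_series c $ m $ n = c m n"
  by (simp add: mk_series_def)

text \<open>
  The series of the complex conjugate function: conjugation exchanges \<open>z\<close> and \<open>cnj z\<close>.
\<close>

definition conj_series :: "series \<Rightarrow> series" where
  "conj_series a = mk_series (\<lambda>m n. cnj (a $ n $ m))"

text \<open>
  The series of \<open>F(w, cnj w)\<close> with \<open>w\<close> given by \<open>a\<close>. If \<open>a\<close> has no constant term, then
  \<open>a ^ i * conj_series a ^ j\<close> has order at least \<open>i + j\<close>, so cutting the sum at \<open>m + n\<close> loses nothing.
\<close>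

definition substitute :: "series \<Rightarrow> series \<Rightarrow> series" where
  "substitute F a = mk_series (\<lambda>m n. \<Sum>i\<le>m + n. \<Sum>j\<le>m + n. F $ i $ j * (a ^ i * conj_series a ^ j) $ m $ n)"

definition scale_coeffs :: "(nat \<Rightarrow> nat \<Rightarrow> complex) \<Rightarrow> series \<Rightarrow> series" where
  "scale_coeffs t a = mk_series (\<lambda>m n. t m n * a $ m $ n)"

definition order_ge :: "nat \<Rightarrow> series \<Rightarrow> bool" where
  "order_ge k a \<longleftrightarrow> (\<forall>m n. m + n < k \<longrightarrow> a $ m $ n = 0)"

lemma order_ge_mono: "order_ge k a \<Longrightarrow> l \<le> k \<Longrightarrow> order_ge l a"
  by (auto simp: order_ge_def)

lemma order_ge_add: "order_ge k a \<Longrightarrow> order_ge k b \<Longrightarrow> order_ge k (a + b)"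
  by (auto simp: order_ge_def)

lemma order_ge_mult:
  assumes "order_ge j a" "order_ge k b"
  shows "order_ge (j + k) (a * b)"
proof -
  have "a $ i $ l * b $ (m - i) $ (n - l) = 0" if "m + n < j + k" "i \<le> m" "l \<le> n" for m n i l
  proof (cases "i + l < j")
    case False
    then have "(m - i) + (n - l) < k" using that by linarith
    then show ?thesis using assms(2) by (simp add: order_ge_def)
  qed (use assms(1) in \<open>simp add: order_ge_def\<close>)
  then show ?thesis
    by (auto simp: order_ge_def series_mult_nth intro!: sum.neutral)
qed

lemma order_ge_power: "order_ge 1 a \<Longrightarrow> order_ge n (a ^ n)"
proof (induction n)
  case (Suc n)
  then show ?case using order_ge_mult[of 1 a n "a ^ n"] by simp
qed (simp add: order_ge_def)

lemma conj_series_nth [simp]: "conj_series a $ m $ n = cnj (a $ n $ m)"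
  by (simp add: conj_series_def)

lemma order_ge_conj: "order_ge k a \<Longrightarrow> order_ge k (conj_series a)"
  by (auto simp: order_ge_def add.commute)

lemma order_ge_diff_mult:
  assumes "order_ge p a" "order_ge q d" "order_ge (k + q) (c - d)" "order_ge (k + p) (a - b)"
  shows "order_ge (k + (p + q)) (a * c - b * d)"
proof -
  have "a * c - b * d = a * (c - d) + (a - b) * d" by (simp add: algebra_simps)
  moreover have "order_ge (k + (p + q)) (a * (c - d))"
    using order_ge_mult[OF assms(1,3)] by (simp add: ac_simps)
  moreover have "order_ge (k + (p + q)) ((a - b) * d)"
    using order_ge_mult[OF assms(4,2)] by (simp add: ac_simps)
  ultimately show ?thesis using order_ge_add by metis
qed

lemma order_ge_diff_power:
  assumes "order_ge 1 a" "order_ge 1 b" "order_ge (k + 1) (a - b)"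
  shows "order_ge (k + n) (a ^ n - b ^ n)"
proof (induction n)
  case (Suc n)
  have "order_ge (k + (1 + n)) (a * a ^ n - b * b ^ n)"
    by (intro order_ge_diff_mult order_ge_power assms Suc)
  then show ?case by simp
qed (simp add: order_ge_def)

lemma substitute_nth:
  "substitute F a $ m $ n = (\<Sum>i\<le>m + n. \<Sum>j\<le>m + n. F $ i $ j * (a ^ i * conj_series a ^ j) $ m $ n)"
  by (simp add: substitute_def)

text \<open>
  As \<open>F\<close> starts in degree 2, substitution into it gains one degree of agreement: series that agree
  up to degree \<open>k\<close> are mapped to series that agree up to degree \<open>k + 1\<close>. This is why the
  iteration below stabilises.
\<close>

lemma order_ge_substitute_diff:
  assumes "order_ge 1 a" "order_ge 1 b" "order_ge (k + 1) (a - b)" "order_ge 2 F"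
  shows "order_ge (k + 2) (substitute F a - substitute F b)"
proof -
  have conj_diff: "conj_series a - conj_series b = conj_series (a - b)"
    by (rule series_eqI) simp
  have *: "order_ge (k + (i + j)) (a ^ i * conj_series a ^ j - b ^ i * conj_series b ^ j)" for i j
    using assms(1-3)
    by (intro order_ge_diff_mult order_ge_power order_ge_diff_power order_ge_conj)
      (auto simp: conj_diff intro: order_ge_conj)
  have "F $ i $ j * (a ^ i * conj_series a ^ j) $ m $ n = F $ i $ j * (b ^ i * conj_series b ^ j) $ m $ n"
    if "m + n < k + 2" for i j m n
  proof (cases "i + j < 2")
    case False
    then show ?thesis using *[of i j] that by (simp add: order_ge_def)
  qed (use assms(4) in \<open>simp add: order_ge_def\<close>)
  then show ?thesis
    by (auto simp: order_ge_def substitute_nth intro!: sum.cong)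
qed

lemma order_ge_substitute:
  assumes "order_ge 1 a" "order_ge 2 F"
  shows "order_ge 2 (substitute F a)"
proof -
  have "F $ i $ j * (a ^ i * conj_series a ^ j) $ m $ n = 0" if "m + n < 2" for i j m n
  proof (cases "i + j < 2")
    case False
    have "order_ge (i + j) (a ^ i * conj_series a ^ j)"
      by (intro order_ge_mult order_ge_power order_ge_conj assms)
    then show ?thesis using False that by (simp add: order_ge_def)
  qed (use assms(2) in \<open>simp add: order_ge_def\<close>)
  then show ?thesis by (auto simp: order_ge_def substitute_nth intro!: sum.neutral)
qed

section \<open>Weighted norms\<close>

text \<open>
  The weighted \<open>\<ell>\<^sup>1\<close> norm with weight \<open>r ^ (m + n)\<close> is at most \<open>B\<close>. Stating it through finite partial sums lets
  the bound pass to coefficientwise limits without any summability argument.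
\<close>

definition norm_le :: "real \<Rightarrow> series \<Rightarrow> real \<Rightarrow> bool" where
  "norm_le r a B \<longleftrightarrow> (\<forall>K. (\<Sum>m\<le>K. \<Sum>n\<le>K. norm (a $ m $ n) * r ^ (m + n)) \<le> B)"

lemma norm_leD: "norm_le r a B \<Longrightarrow> (\<Sum>m\<le>K. \<Sum>n\<le>K. norm (a $ m $ n) * r ^ (m + n)) \<le> B"
  by (simp add: norm_le_def)

lemma norm_le_mono: "norm_le r a B \<Longrightarrow> B \<le> C \<Longrightarrow> norm_le r a C"
  unfolding norm_le_def by (meson order_trans)

lemma norm_le_nonneg: "norm_le r a B \<Longrightarrow> 0 \<le> B"
  using norm_leD[of r a B 0] by simp (meson norm_ge_zero order_trans)

lemma norm_le_add:
  assumes "norm_le r a B" "norm_le r b C" "0 \<le> r"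
  shows "norm_le r (a + b) (B + C)"
  unfolding norm_le_def
proof
  fix K
  have "(\<Sum>m\<le>K. \<Sum>n\<le>K. norm ((a + b) $ m $ n) * r ^ (m + n)) \<le>
      (\<Sum>m\<le>K. \<Sum>n\<le>K. norm (a $ m $ n) * r ^ (m + n) + norm (b $ m $ n) * r ^ (m + n))"
    using assms(3)
    by (intro sum_mono) (simp add: norm_triangle_ineq mult_right_mono flip: distrib_right)
  also have "\<dots> \<le> B + C"
    using norm_leD[OF assms(1), of K] norm_leD[OF assms(2), of K] by (simp add: sum.distrib)
  finally show "(\<Sum>m\<le>K. \<Sum>n\<le>K. norm ((a + b) $ m $ n) * r ^ (m + n)) \<le> B + C" .
qed

lemma norm_le_coeffs:
  assumes "norm_le r a B" "\<And>m n. norm (b $ m $ n) \<le> norm (a $ m $ n)" "0 \<le> r"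
  shows "norm_le r b B"
  unfolding norm_le_def
proof
  fix K
  have "(\<Sum>m\<le>K. \<Sum>n\<le>K. norm (b $ m $ n) * r ^ (m + n)) \<le>
      (\<Sum>m\<le>K. \<Sum>n\<le>K. norm (a $ m $ n) * r ^ (m + n))"
    using assms(2,3) by (intro sum_mono mult_right_mono) auto
  also have "\<dots> \<le> B" by (rule norm_leD[OF assms(1)])
  finally show "(\<Sum>m\<le>K. \<Sum>n\<le>K. norm (b $ m $ n) * r ^ (m + n)) \<le> B" .
qed

lemma norm_le_conj: "norm_le r a B \<Longrightarrow> norm_le r (conj_series a) B"
  unfolding norm_le_def by (subst sum.swap) (simp add: add.commute)

lemma norm_le_one: "norm_le r 1 1"
proof -
  have "(\<Sum>m\<le>K. \<Sum>n\<le>K. norm ((1 :: series) $ m $ n) * r ^ (m + n)) =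
      (\<Sum>m\<in>{0::nat}. \<Sum>n\<in>{0::nat}. 1)" for K
    by (intro sum.mono_neutral_cong_right) (auto simp: series_one_nth)
  then show ?thesis by (simp add: norm_le_def)
qed

lemma norm_le_X: "0 \<le> r \<Longrightarrow> norm_le r fps_X r"
proof -
  assume r: "0 \<le> r"
  have "(\<Sum>m\<le>K. \<Sum>n\<le>K. norm ((fps_X :: series) $ m $ n) * r ^ (m + n)) \<le>
      (\<Sum>m\<le>Suc K. \<Sum>n\<le>Suc K. norm ((fps_X :: series) $ m $ n) * r ^ (m + n))" for K
    using r by (intro order_trans[OF sum_mono sum_mono2] sum_mono2) (auto intro!: sum_nonneg)
  also have "\<dots> K = (\<Sum>m\<in>{1::nat}. \<Sum>n\<in>{0::nat}. r)" for K
    by (intro sum.mono_neutral_cong_right) (auto simp: series_X_nth)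
  finally show ?thesis by (simp add: norm_le_def)
qed

text \<open>
  The finite sums of a Cauchy product cover a triangle of the square of index pairs.
\<close>

lemma triangle_sum_le:
  fixes f :: "nat \<Rightarrow> nat \<Rightarrow> real"
  assumes "\<And>i l. 0 \<le> f i l"
  shows "(\<Sum>m\<le>K. \<Sum>i\<le>m. f i (m - i)) \<le> (\<Sum>i\<le>K. \<Sum>l\<le>K. f i l)"
proof -
  have "(\<Sum>m\<le>K. \<Sum>i\<le>m. f i (m - i)) = (\<Sum>(i, l)\<in>{(i, l). i + l \<le> K}. f i l)"
    by (rule sum.triangle_reindex_eq[symmetric])
  also have "\<dots> \<le> (\<Sum>(i, l)\<in>{..K} \<times> {..K}. f i l)"
    by (intro sum_mono2) (auto simp: assms)
  finally show ?thesis by (simp add: sum.cartesian_product)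
qed

lemma norm_le_mult:
  assumes "norm_le r a B" "norm_le r b C" "0 \<le> r"
  shows "norm_le r (a * b) (B * C)"
  unfolding norm_le_def
proof
  fix K
  define \<alpha> where "\<alpha> i j = norm (a $ i $ j) * r ^ (i + j)" for i j
  define \<beta> where "\<beta> i j = norm (b $ i $ j) * r ^ (i + j)" for i j
  have nonneg: "0 \<le> \<alpha> i j" "0 \<le> \<beta> i j" for i j using assms(3) by (auto simp: \<alpha>_def \<beta>_def)
  have "norm ((a * b) $ m $ n) * r ^ (m + n) \<le> (\<Sum>i\<le>m. \<Sum>j\<le>n. \<alpha> i j * \<beta> (m - i) (n - j))" for m n
  proof -
    have "norm ((a * b) $ m $ n) \<le> (\<Sum>i\<le>m. \<Sum>j\<le>n. norm (a $ i $ j) * norm (b $ (m - i) $ (n - j)))"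
      unfolding series_mult_nth by (intro sum_norm_le) (auto simp: norm_mult intro!: sum_norm_le)
    then have "norm ((a * b) $ m $ n) * r ^ (m + n) \<le>
        (\<Sum>i\<le>m. \<Sum>j\<le>n. norm (a $ i $ j) * norm (b $ (m - i) $ (n - j))) * r ^ (m + n)"
      using assms(3) by (intro mult_right_mono) auto
    also have "\<dots> = (\<Sum>i\<le>m. \<Sum>j\<le>n. \<alpha> i j * \<beta> (m - i) (n - j))"
      unfolding sum_distrib_right
    proof (intro sum.cong refl)
      fix i j assume "i \<in> {..m}" "j \<in> {..n}"
      then have "m + n = (i + j) + ((m - i) + (n - j))" by simp
      then have "r ^ (m + n) = r ^ (i + j) * r ^ ((m - i) + (n - j))" by (metis power_add)
      then show "norm (a $ i $ j) * norm (b $ (m - i) $ (n - j)) * r ^ (m + n) =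
          \<alpha> i j * \<beta> (m - i) (n - j)"
        by (simp add: \<alpha>_def \<beta>_def)
    qed
    finally show ?thesis .
  qed
  then have "(\<Sum>m\<le>K. \<Sum>n\<le>K. norm ((a * b) $ m $ n) * r ^ (m + n)) \<le>
      (\<Sum>m\<le>K. \<Sum>n\<le>K. \<Sum>i\<le>m. \<Sum>j\<le>n. \<alpha> i j * \<beta> (m - i) (n - j))"
    by (intro sum_mono)
  also have "\<dots> = (\<Sum>m\<le>K. \<Sum>i\<le>m. \<Sum>n\<le>K. \<Sum>j\<le>n. \<alpha> i j * \<beta> (m - i) (n - j))"
    by (intro sum.cong refl sum.swap)
  also have "\<dots> \<le> (\<Sum>i\<le>K. \<Sum>l\<le>K. \<Sum>n\<le>K. \<Sum>j\<le>n. \<alpha> i j * \<beta> l (n - j))"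
    by (rule triangle_sum_le[where f = "\<lambda>i l. \<Sum>n\<le>K. \<Sum>j\<le>n. \<alpha> i j * \<beta> l (n - j)"])
      (auto intro!: sum_nonneg mult_nonneg_nonneg nonneg)
  also have "\<dots> \<le> (\<Sum>i\<le>K. \<Sum>l\<le>K. \<Sum>j\<le>K. \<Sum>k\<le>K. \<alpha> i j * \<beta> l k)"
    by (intro sum_mono triangle_sum_le mult_nonneg_nonneg nonneg)
  also have "\<dots> = (\<Sum>i\<le>K. \<Sum>l\<le>K. (\<Sum>j\<le>K. \<alpha> i j) * (\<Sum>k\<le>K. \<beta> l k))"
    by (simp only: sum_product)
  also have "\<dots> = (\<Sum>i\<le>K. \<Sum>j\<le>K. \<alpha> i j) * (\<Sum>l\<le>K. \<Sum>k\<le>K. \<beta> l k)"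
    by (rule sum_product[symmetric])
  also have "\<dots> \<le> B * C"
    using norm_leD[OF assms(1), of K] norm_leD[OF assms(2), of K] norm_le_nonneg[OF assms(1)]
    by (intro mult_mono) (auto simp: \<alpha>_def \<beta>_def assms(3) intro!: sum_nonneg)
  finally show "(\<Sum>m\<le>K. \<Sum>n\<le>K. norm ((a * b) $ m $ n) * r ^ (m + n)) \<le> B * C" .
qed

lemma norm_le_power: "norm_le r a B \<Longrightarrow> 0 \<le> r \<Longrightarrow> norm_le r (a ^ n) (B ^ n)"
  by (induction n) (auto intro: norm_le_one norm_le_mult)

lemma norm_le_monomial: "norm_le r a B \<Longrightarrow> 0 \<le> r \<Longrightarrow> norm_le r (a ^ i * conj_series a ^ j) (B ^ (i + j))"
  unfolding power_add by (intro norm_le_mult norm_le_power norm_le_conj)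

text \<open>
  Substitution is bounded by the majorant \<open>\<Sum> norm (F $ i $ j) * B ^ (i + j)\<close>, and the factor
  \<open>(B / \<rho>)\<^sup>2\<close>, available because \<open>F\<close> starts in degree 2, makes the bound quadratically small in \<open>B\<close>.
\<close>

lemma norm_le_substitute:
  assumes F: "norm_le \<rho> F M" "order_ge 2 F" and a: "norm_le r a B" and r: "0 \<le> r" and B: "B \<le> \<rho>" "0 < \<rho>"
  shows "norm_le r (substitute F a) (M * (B / \<rho>)\<^sup>2)"
  unfolding norm_le_def
proof
  fix K
  let ?c = "\<lambda>i j m n. norm ((a ^ i * conj_series a ^ j) $ m $ n) * r ^ (m + n)"
  have B0: "0 \<le> B" by (rule norm_le_nonneg[OF a])
  have "norm (substitute F a $ m $ n) * r ^ (m + n) \<le>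
      (\<Sum>i\<le>2 * K. \<Sum>j\<le>2 * K. norm (F $ i $ j) * ?c i j m n)" if "m \<le> K" "n \<le> K" for m n
  proof -
    have "norm (substitute F a $ m $ n) \<le>
        (\<Sum>i\<le>m + n. \<Sum>j\<le>m + n. norm (F $ i $ j) * norm ((a ^ i * conj_series a ^ j) $ m $ n))"
      unfolding substitute_nth by (intro sum_norm_le) (auto simp: norm_mult intro!: sum_norm_le)
    also have "\<dots> \<le> (\<Sum>i\<le>2 * K. \<Sum>j\<le>2 * K. norm (F $ i $ j) * norm ((a ^ i * conj_series a ^ j) $ m $ n))"
      using that by (intro order_trans[OF sum_mono sum_mono2] sum_mono2) (auto intro!: sum_nonneg)
    finally show ?thesis
      using r by (simp add: mult.assoc mult_right_mono sum_distrib_right[symmetric] flip: mult.assoc)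
  qed
  then have "(\<Sum>m\<le>K. \<Sum>n\<le>K. norm (substitute F a $ m $ n) * r ^ (m + n)) \<le>
      (\<Sum>m\<le>K. \<Sum>n\<le>K. \<Sum>i\<le>2 * K. \<Sum>j\<le>2 * K. norm (F $ i $ j) * ?c i j m n)"
    by (intro sum_mono) auto
  also have "\<dots> = (\<Sum>(m, n)\<in>{..K} \<times> {..K}. \<Sum>(i, j)\<in>{..2 * K} \<times> {..2 * K}. norm (F $ i $ j) * ?c i j m n)"
    by (simp only: sum.cartesian_product[symmetric])
  also have "\<dots> = (\<Sum>(i, j)\<in>{..2 * K} \<times> {..2 * K}. \<Sum>(m, n)\<in>{..K} \<times> {..K}. norm (F $ i $ j) * ?c i j m n)"
    unfolding case_prod_unfold by (rule sum.swap)
  also have "\<dots> = (\<Sum>i\<le>2 * K. \<Sum>j\<le>2 * K. norm (F $ i $ j) * (\<Sum>m\<le>K. \<Sum>n\<le>K. ?c i j m n))"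
    by (simp add: sum_distrib_left flip: sum.cartesian_product)
  also have "\<dots> \<le> (\<Sum>i\<le>2 * K. \<Sum>j\<le>2 * K. (norm (F $ i $ j) * \<rho> ^ (i + j)) * (B / \<rho>)\<^sup>2)"
  proof (intro sum_mono)
    fix i j :: nat
    show "norm (F $ i $ j) * (\<Sum>m\<le>K. \<Sum>n\<le>K. ?c i j m n) \<le> norm (F $ i $ j) * \<rho> ^ (i + j) * (B / \<rho>)\<^sup>2"
    proof (cases "i + j < 2")
      case True
      then show ?thesis using F(2) by (simp add: order_ge_def)
    next
      case False
      have "(\<Sum>m\<le>K. \<Sum>n\<le>K. ?c i j m n) \<le> B ^ (i + j)"
        by (rule norm_leD[OF norm_le_monomial[OF a r]])
      also have "\<dots> = \<rho> ^ (i + j) * (B / \<rho>) ^ (i + j)"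
        using B by (simp add: power_divide)
      also have "\<dots> \<le> \<rho> ^ (i + j) * (B / \<rho>)\<^sup>2"
        using B B0 False by (intro mult_left_mono power_decreasing) auto
      finally show ?thesis by (simp add: mult.assoc mult_left_mono)
    qed
  qed
  also have "\<dots> = (\<Sum>i\<le>2 * K. \<Sum>j\<le>2 * K. norm (F $ i $ j) * \<rho> ^ (i + j)) * (B / \<rho>)\<^sup>2"
    by (simp only: sum_distrib_right)
  also have "\<dots> \<le> M * (B / \<rho>)\<^sup>2"
    by (intro mult_right_mono norm_leD[OF F(1)]) auto
  finally show "(\<Sum>m\<le>K. \<Sum>n\<le>K. norm (substitute F a $ m $ n) * r ^ (m + n)) \<le> M * (B / \<rho>)\<^sup>2" .
qed

section \<open>The fixed point equation\<close>

text \<open>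
  Successive approximations to a solution of \<open>a = z + t \<sqdot> F(a, cnj a)\<close>, where \<open>t\<close> multiplies the
  coefficients. Two instances are used: \<open>t\<close> the inverse of the homological operator, and
  \<open>t = - 1\<close>, which inverts the map \<open>z + F(z, cnj z)\<close>.
\<close>

fun iterate :: "(nat \<Rightarrow> nat \<Rightarrow> complex) \<Rightarrow> series \<Rightarrow> nat \<Rightarrow> series" where
  "iterate t F 0 = fps_X"
| "iterate t F (Suc k) = fps_X + scale_coeffs t (substitute F (iterate t F k))"

definition solution :: "(nat \<Rightarrow> nat \<Rightarrow> complex) \<Rightarrow> series \<Rightarrow> series" where
  "solution t F = mk_series (\<lambda>m n. iterate t F (m + n) $ m $ n)"

lemma scale_coeffs_nth [simp]: "scale_coeffs t a $ m $ n = t m n * a $ m $ n"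
  by (simp add: scale_coeffs_def)

lemma order_ge_scale: "order_ge k a \<Longrightarrow> order_ge k (scale_coeffs t a)"
  by (auto simp: order_ge_def)

lemma order_ge_X: "order_ge 1 (fps_X :: series)"
  by (auto simp: order_ge_def series_X_nth)

lemma order_ge_iterate:
  assumes "order_ge 2 F"
  shows "order_ge 1 (iterate t F k)"
proof (induction k)
  case (Suc k)
  have "order_ge 2 (scale_coeffs t (substitute F (iterate t F k)))"
    by (intro order_ge_scale order_ge_substitute Suc assms)
  then have "order_ge 1 (scale_coeffs t (substitute F (iterate t F k)))"
    by (rule order_ge_mono) simp
  then show ?case unfolding iterate.simps by (intro order_ge_add order_ge_X)
qed (simp add: order_ge_X del: One_nat_def)

lemma iterate_step:
  assumes "order_ge 2 F"
  shows "order_ge (k + 2) (iterate t F (Suc k) - iterate t F k)"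
proof (induction k)
  case 0
  have "order_ge 2 (scale_coeffs t (substitute F fps_X))"
    by (intro order_ge_scale order_ge_substitute order_ge_X assms)
  then show ?case by (simp add: numeral_2_eq_2)
next
  case (Suc k)
  let ?a = "iterate t F (Suc k)" and ?b = "iterate t F k"
  have "order_ge (Suc k + 2) (substitute F ?a - substitute F ?b)"
    using Suc by (intro order_ge_substitute_diff order_ge_iterate assms) simp
  then have "order_ge (Suc k + 2) (scale_coeffs t (substitute F ?a - substitute F ?b))"
    by (rule order_ge_scale)
  moreover have "iterate t F (Suc (Suc k)) - iterate t F (Suc k) = scale_coeffs t (substitute F ?a - substitute F ?b)"
    by (rule series_eqI) (simp add: algebra_simps)
  ultimately show ?case by simp
qed

text \<open>
  Step \<open>k\<close> is final up to degree \<open>k + 1\<close>.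
\<close>

lemma iterate_stable:
  assumes "order_ge 2 F" "m + n \<le> k + 1" "k \<le> l"
  shows "iterate t F l $ m $ n = iterate t F k $ m $ n"
  using assms(3)
proof (induction l rule: dec_induct)
  case (step l)
  then have "(iterate t F (Suc l) - iterate t F l) $ m $ n = 0"
    using iterate_step[OF assms(1), of l t] assms(2) by (simp add: order_ge_def del: iterate.simps)
  then show ?case using step by (simp del: iterate.simps)
qed simp

lemma solution_nth:
  assumes "order_ge 2 F" "m + n \<le> k + 1"
  shows "solution t F $ m $ n = iterate t F k $ m $ n"
proof -
  have "iterate t F (m + n) $ m $ n = iterate t F (m + n + k) $ m $ n"
    by (rule iterate_stable[symmetric, OF assms(1)]) auto
  also have "\<dots> = iterate t F k $ m $ n"
    by (rule iterate_stable[OF assms]) auto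
  finally show ?thesis by (simp add: solution_def)
qed

lemma order_ge_solution: "order_ge 2 F \<Longrightarrow> order_ge 1 (solution t F)"
  using order_ge_iterate[of F t] by (auto simp: order_ge_def solution_def)

lemma substitute_solution_nth:
  assumes "order_ge 2 F" "m + n \<le> k + 1"
  shows "substitute F (solution t F) $ m $ n = substitute F (iterate t F k) $ m $ n"
proof -
  have "order_ge (k + 1) (solution t F - iterate t F k)"
    using solution_nth[OF assms(1), of _ _ k t] by (auto simp: order_ge_def)
  then have "order_ge (k + 2) (substitute F (solution t F) - substitute F (iterate t F k))"
    by (intro order_ge_substitute_diff order_ge_solution order_ge_iterate assms)
  then show ?thesis using assms(2) by (simp add: order_ge_def)
qed

lemma solution_eq:
  assumes "order_ge 2 F"
  shows "solution t F = fps_X + scale_coeffs t (substitute F (solution t F))"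
proof (rule series_eqI)
  fix m n
  have "solution t F $ m $ n = iterate t F (Suc (m + n)) $ m $ n"
    by (rule solution_nth[OF assms]) simp
  also have "\<dots> = (fps_X + scale_coeffs t (substitute F (iterate t F (m + n)))) $ m $ n"
    by simp
  also have "\<dots> = (fps_X + scale_coeffs t (substitute F (solution t F))) $ m $ n"
    using substitute_solution_nth[OF assms, of m n "m + n" t] by simp
  finally show "solution t F $ m $ n = (fps_X + scale_coeffs t (substitute F (solution t F))) $ m $ n" .
qed

text \<open>
  For small \<open>r\<close> the ball of radius \<open>2 * r\<close> in the weighted norm is mapped into itself, because the
  identity contributes \<open>r\<close> and the nonlinear part is quadratically small. All iterates stay
  in this ball, hence so does their coefficientwise limit.
\<close>

lemma norm_le_solution:
  assumes F: "order_ge 2 F" "norm_le \<rho> F M" "0 < \<rho>" and t: "\<And>m n. norm (t m n) \<le> 1"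
  obtains r where "0 < r" "2 * r \<le> \<rho>" "norm_le r (solution t F) (2 * r)"
proof -
  have M: "0 \<le> M" by (rule norm_le_nonneg[OF F(2)])
  \<comment> \<open>chosen so that \<open>M * (2 * r / \<rho>)\<^sup>2 \<le> r\<close>\<close>
  define r where "r = min (\<rho> / 2) (\<rho>\<^sup>2 / (4 * (M + 1)))"
  have r: "0 < r" "2 * r \<le> \<rho>" using F(3) M by (auto simp: r_def)
  have "r \<le> \<rho>\<^sup>2 / (4 * (M + 1))" by (simp add: r_def)
  then have "r * (4 * (M + 1)) \<le> \<rho>\<^sup>2" using M by (simp add: pos_le_divide_eq)
  then have "4 * M * r \<le> \<rho>\<^sup>2" using r by (simp add: algebra_simps)
  then have "4 * M * r * r \<le> \<rho>\<^sup>2 * r" using r by (intro mult_right_mono) auto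
  then have small: "M * (2 * r / \<rho>)\<^sup>2 \<le> r"
    using F(3) by (simp add: power_divide divide_le_eq power2_eq_square mult_ac)
  have it: "norm_le r (iterate t F k) (2 * r)" for k
  proof (induction k)
    case 0
    show ?case using r norm_le_X[of r] by (auto intro: norm_le_mono)
  next
    case (Suc k)
    have "norm_le r (substitute F (iterate t F k)) r"
      using norm_le_substitute[OF F(2,1) Suc] r F(3) small by (auto intro: norm_le_mono)
    then have "norm_le r (scale_coeffs t (substitute F (iterate t F k))) r"
      using r t by (elim norm_le_coeffs) (auto simp: norm_mult intro!: mult_left_le_one_le)
    then show ?case
      using norm_le_add[OF norm_le_X[of r], of _ r] r by auto
  qed
  have "norm_le r (solution t F) (2 * r)"
    unfolding norm_le_def
  proof
    fix K
    have "(\<Sum>m\<le>K. \<Sum>n\<le>K. norm (solution t F $ m $ n) * r ^ (m + n)) =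
        (\<Sum>m\<le>K. \<Sum>n\<le>K. norm (iterate t F (2 * K) $ m $ n) * r ^ (m + n))"
      by (intro sum.cong refl arg_cong2[where f = times] arg_cong[where f = norm] solution_nth F(1)) auto
    also have "\<dots> \<le> 2 * r" by (rule norm_leD[OF it])
    finally show "(\<Sum>m\<le>K. \<Sum>n\<le>K. norm (solution t F $ m $ n) * r ^ (m + n)) \<le> 2 * r" .
  qed
  then show thesis using r that by blast
qed

section \<open>Evaluation\<close>

definition series_term :: "series \<Rightarrow> complex \<Rightarrow> nat \<times> nat \<Rightarrow> complex" where
  "series_term a z = (\<lambda>(m, n). a $ m $ n * z ^ m * cnj z ^ n)"

definition series_eval :: "series \<Rightarrow> complex \<Rightarrow> complex" where
  "series_eval a z = infsum (series_term a z) UNIV"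

lemma norm_series_term: "norm (series_term a z (m, n)) = norm (a $ m $ n) * norm z ^ (m + n)"
  by (simp add: series_term_def norm_mult norm_power power_add)

lemma norm_le_finite_sum:
  assumes "norm_le r a B" "0 \<le> r" "finite S"
  shows "(\<Sum>(m, n)\<in>S. norm (a $ m $ n) * r ^ (m + n)) \<le> B"
proof -
  obtain K where K: "fst ` S \<union> snd ` S \<subseteq> {..K}"
    using finite_nat_iff_bounded_le[of "fst ` S \<union> snd ` S"] assms(3) by auto
  have "(\<Sum>(m, n)\<in>S. norm (a $ m $ n) * r ^ (m + n)) \<le> (\<Sum>(m, n)\<in>{..K} \<times> {..K}. norm (a $ m $ n) * r ^ (m + n))"
    using K assms(2) by (intro sum_mono2) (auto simp: image_subset_iff)
  also have "\<dots> \<le> B"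
    using norm_leD[OF assms(1), of K] by (simp add: sum.cartesian_product)
  finally show ?thesis .
qed

lemma norm_le_weights_summable:
  assumes "norm_le r a B" "0 \<le> r"
  shows "(\<lambda>(m, n). norm (a $ m $ n) * r ^ (m + n)) summable_on UNIV"
  using assms norm_le_finite_sum[OF assms]
  by (intro nonneg_bdd_above_summable_on bdd_aboveI2[of _ _ B]) auto

lemma series_term_abs_summable:
  assumes "norm_le r a B" "norm z \<le> r"
  shows "series_term a z abs_summable_on UNIV"
proof -
  have r: "0 \<le> r" using assms(2) norm_ge_zero order_trans by blast
  show ?thesis
    using norm_le_weights_summable[OF assms(1) r] assms(2)
    by (rule_tac summable_on_comparison_test[where f = "\<lambda>(m, n). norm (a $ m $ n) * r ^ (m + n)"])
      (auto simp: norm_series_term intro!: mult_left_mono power_mono)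
qed

lemma series_eval_has_sum:
  assumes "norm_le r a B" "norm z \<le> r"
  shows "(series_term a z has_sum series_eval a z) UNIV"
  unfolding series_eval_def
  by (rule has_sum_infsum[OF abs_summable_summable[OF series_term_abs_summable[OF assms]]])

lemma infsum_norm_series_term_le:
  assumes "norm_le r a B" "norm z \<le> r"
  shows "infsum (\<lambda>x. norm (series_term a z x)) UNIV \<le> B"
proof (rule infsum_le_finite_sums)
  show "(\<lambda>x. norm (series_term a z x)) summable_on UNIV"
    by (rule series_term_abs_summable[OF assms])
  fix S :: "(nat \<times> nat) set" assume S: "finite S" "S \<subseteq> UNIV"
  have r: "0 \<le> r" using assms(2) norm_ge_zero order_trans by blast
  have "(\<Sum>x\<in>S. norm (series_term a z x)) \<le> (\<Sum>(m, n)\<in>S. norm (a $ m $ n) * r ^ (m + n))"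
    using assms(2) by (intro sum_mono) (auto simp: norm_series_term intro!: mult_left_mono power_mono)
  also have "\<dots> \<le> B" by (rule norm_le_finite_sum[OF assms(1) r S(1)])
  finally show "(\<Sum>x\<in>S. norm (series_term a z x)) \<le> B" .
qed

lemma norm_series_eval_le:
  assumes "norm_le r a B" "norm z \<le> r"
  shows "norm (series_eval a z) \<le> B"
  using norm_infsum_bound[of "series_term a z" UNIV] series_term_abs_summable[OF assms] infsum_norm_series_term_le[OF assms]
  unfolding series_eval_def by (meson order_trans)

lemma series_eval_eqI: "(series_term a z has_sum s) UNIV \<Longrightarrow> series_eval a z = s"
  unfolding series_eval_def by (rule infsumI)

lemma series_eval_add:
  assumes "norm_le r a B" "norm_le r b C" "norm z \<le> r"
  shows "series_eval (a + b) z = series_eval a z + series_eval b z"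
proof -
  have "series_term (a + b) z = (\<lambda>x. series_term a z x + series_term b z x)"
    by (auto simp: series_term_def algebra_simps)
  then show ?thesis
    using has_sum_add[OF series_eval_has_sum[OF assms(1,3)] series_eval_has_sum[OF assms(2,3)]]
    by (intro series_eval_eqI) simp
qed

lemma series_eval_conj:
  assumes "norm_le r a B" "norm z \<le> r"
  shows "series_eval (conj_series a) z = cnj (series_eval a z)"
proof (rule series_eval_eqI)
  have "((\<lambda>x. cnj (series_term a z x)) has_sum cnj (series_eval a z)) (UNIV \<times> UNIV)"
    using series_eval_has_sum[OF assms] by simp
  then have "((\<lambda>(x, y). cnj (series_term a z (y, x))) has_sum cnj (series_eval a z)) (UNIV \<times> UNIV)"
    by (subst (asm) has_sum_swap)
  moreover have "(\<lambda>(x, y). cnj (series_term a z (y, x))) = series_term (conj_series a) z"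
    by (auto simp: series_term_def)
  ultimately show "(series_term (conj_series a) z has_sum cnj (series_eval a z)) UNIV" by simp
qed

lemma series_eval_X: "series_eval fps_X z = z"
proof (rule series_eval_eqI)
  show "(series_term fps_X z has_sum z) UNIV"
    by (rule has_sum_finite_neutralI[of "{(1, 0)}"])
      (auto simp: series_term_def series_X_nth split: if_splits)
qed

lemma series_eval_one: "series_eval 1 z = 1"
proof (rule series_eval_eqI)
  show "(series_term 1 z has_sum 1) UNIV"
    by (rule has_sum_finite_neutralI[of "{(0, 0)}"])
      (auto simp: series_term_def series_one_nth split: if_splits)
qed

lemma has_sum_product_abs:
  fixes f :: "'x \<Rightarrow> complex" and g :: "'y \<Rightarrow> complex"
  assumes "f abs_summable_on A" "g abs_summable_on B"
  shows "((\<lambda>(x, y). f x * g y) has_sum (infsum f A * infsum g B)) (A \<times> B)"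
proof -
  have inner: "((\<lambda>y. f x * g y) has_sum (f x * infsum g B)) B" for x
    by (rule has_sum_cmult_right[OF has_sum_infsum[OF abs_summable_summable[OF assms(2)]]])
  have "(\<lambda>(x, y). f x * g y) abs_summable_on A \<times> B"
    unfolding Infinite_Sum.abs_summable_on_Sigma_iff
  proof (intro conjI ballI)
    fix x show "(\<lambda>y. case (x, y) of (x, y) \<Rightarrow> f x * g y) abs_summable_on B"
      using assms(2) by (simp add: norm_mult summable_on_cmult_right)
    show "(\<lambda>x. \<Sum>\<^sub>\<infinity>y\<in>B. norm (case (x, y) of (x, y) \<Rightarrow> f x * g y)) abs_summable_on A"
      using assms(1) summable_on_cmult_left[OF assms(1), of "\<Sum>\<^sub>\<infinity>y\<in>B. norm (g y)"]
      by (simp add: norm_mult infsum_cmult_right' infsum_nonneg)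
  qed
  then have "(\<lambda>(x, y). f x * g y) summable_on A \<times> B" by (rule abs_summable_summable)
  moreover have "((\<lambda>x. f x * infsum g B) has_sum (infsum f A * infsum g B)) A"
    by (rule has_sum_cmult_left[OF has_sum_infsum[OF abs_summable_summable[OF assms(1)]]])
  ultimately show ?thesis
    using inner by (intro has_sum_SigmaI[where g = "\<lambda>x. f x * infsum g B"]) auto
qed

text \<open>
  Cauchy product: the pairs of index pairs are regrouped by their sum.
\<close>

lemma series_eval_mult:
  assumes "norm_le r a B" "norm_le r b C" "norm z \<le> r"
  shows "series_eval (a * b) z = series_eval a z * series_eval b z"
proof (rule series_eval_eqI)
  let ?f = "\<lambda>(x, y). series_term a z x * series_term b z y"
  let ?S = "SIGMA (m, n) : UNIV. {..m} \<times> {..n :: nat}"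
  have "(?f has_sum (series_eval a z * series_eval b z)) (UNIV \<times> UNIV)"
    unfolding series_eval_def
    by (intro has_sum_product_abs series_term_abs_summable[OF assms(1,3)] series_term_abs_summable[OF assms(2,3)])
  also have "?this \<longleftrightarrow> ((\<lambda>((m, n), (i, j)). series_term a z (i, j) * series_term b z (m - i, n - j))
      has_sum (series_eval a z * series_eval b z)) ?S"
    by (rule has_sum_reindex_bij_witness[where j = "\<lambda>((i, j), (k, l)). ((i + k, j + l), (i, j))"
          and i = "\<lambda>((m, n), (i, j)). ((i, j), (m - i, n - j))"]) auto
  finally have "((\<lambda>(m, n). \<Sum>(i, j)\<in>{..m} \<times> {..n}. series_term a z (i, j) * series_term b z (m - i, n - j))
      has_sum (series_eval a z * series_eval b z)) UNIV"
    using has_sum_SigmaD[where A = UNIV and B = "\<lambda>(m, n). {..m} \<times> {..n}"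
        and g = "\<lambda>(m, n). \<Sum>(i, j)\<in>{..m} \<times> {..n}. series_term a z (i, j) * series_term b z (m - i, n - j)"]
    by (force intro!: has_sum_finiteI simp: case_prod_unfold)
  moreover have "(\<Sum>(i, j)\<in>{..m} \<times> {..n}. series_term a z (i, j) * series_term b z (m - i, n - j)) =
      series_term (a * b) z (m, n)" for m n
  proof -
    have "(\<Sum>(i, j)\<in>{..m} \<times> {..n}. series_term a z (i, j) * series_term b z (m - i, n - j)) =
        (\<Sum>(i, j)\<in>{..m} \<times> {..n}. a $ i $ j * b $ (m - i) $ (n - j) * z ^ m * cnj z ^ n)"
    proof (intro sum.cong refl)
      fix x assume "x \<in> {..m} \<times> {..n}"
      then obtain i j where x: "x = (i, j)" "i \<le> m" "j \<le> n" by auto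
      then have "z ^ m = z ^ i * z ^ (m - i)" "cnj z ^ n = cnj z ^ j * cnj z ^ (n - j)"
        by (simp_all flip: power_add)
      then show "(case x of (i, j) \<Rightarrow> series_term a z (i, j) * series_term b z (m - i, n - j)) =
          (case x of (i, j) \<Rightarrow> a $ i $ j * b $ (m - i) $ (n - j) * z ^ m * cnj z ^ n)"
        by (simp add: series_term_def x(1))
    qed
    then show ?thesis
      by (simp add: series_term_def series_mult_nth sum_distrib_right flip: sum.cartesian_product)
  qed
  ultimately show "(series_term (a * b) z has_sum (series_eval a z * series_eval b z)) UNIV"
    by (simp add: case_prod_unfold)
qed

lemma series_eval_power:
  assumes "norm_le r a B" "norm z \<le> r"
  shows "series_eval (a ^ n) z = series_eval a z ^ n"
proof (induction n)
  case (Suc n)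
  have "0 \<le> r" using assms(2) norm_ge_zero order_trans by blast
  then show ?case
    using series_eval_mult[OF assms(1) norm_le_power[OF assms(1)] assms(2), of n] Suc by simp
qed (simp add: series_eval_one)

lemma series_eval_monomial:
  assumes "norm_le r a B" "norm z \<le> r"
  shows "series_eval (a ^ i * conj_series a ^ j) z = series_eval a z ^ i * cnj (series_eval a z) ^ j"
proof -
  have r: "0 \<le> r" using assms(2) norm_ge_zero order_trans by blast
  show ?thesis
    using series_eval_mult[OF norm_le_power[OF assms(1) r] norm_le_power[OF norm_le_conj[OF assms(1)] r] assms(2)]
    by (simp add: series_eval_power[OF assms] series_eval_power[OF norm_le_conj[OF assms(1)] assms(2)]
        series_eval_conj[OF assms])
qed

text \<open>
  Both sides are the same absolutely convergent double sum over the monomials of \<open>F\<close> and the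
  coefficients of their substituted powers, summed in the two possible orders.
\<close>

lemma series_eval_substitute:
  assumes F: "norm_le \<rho> F M" and a: "norm_le r a B" "order_ge 1 a" and B: "B \<le> \<rho>" and z: "norm z \<le> r"
  shows "series_eval (substitute F a) z = series_eval F (series_eval a z)"
proof -
  have r: "0 \<le> r" using z norm_ge_zero order_trans by blast
  have B0: "0 \<le> B" by (rule norm_le_nonneg[OF a(1)])
  let ?mon = "\<lambda>x. a ^ fst x * conj_series a ^ snd x"
  let ?f = "\<lambda>(x, y). F $ fst x $ snd x * series_term (?mon x) z y"
  let ?w = "series_eval a z"
  have mon: "norm_le r (?mon x) (B ^ (fst x + snd x))" for x
    by (rule norm_le_monomial[OF a(1) r])
  have "?f abs_summable_on UNIV \<times> UNIV"
    unfolding Infinite_Sum.abs_summable_on_Sigma_iff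
  proof (intro conjI ballI)
    fix x show "(\<lambda>y. ?f (x, y)) abs_summable_on UNIV"
      using series_term_abs_summable[OF mon z, of x] by (simp add: norm_mult summable_on_cmult_right)
    have "(\<lambda>x. norm (F $ fst x $ snd x) * \<rho> ^ (fst x + snd x)) summable_on UNIV"
      using norm_le_weights_summable[OF F] B B0 by (simp add: case_prod_unfold)
    then show "(\<lambda>x. \<Sum>\<^sub>\<infinity>y. norm (?f (x, y))) abs_summable_on UNIV"
    proof (rule summable_on_comparison_test)
      fix x :: "nat \<times> nat"
      have "(\<Sum>\<^sub>\<infinity>y. norm (series_term (?mon x) z y)) \<le> B ^ (fst x + snd x)"
        by (rule infsum_norm_series_term_le[OF mon z])
      also have "\<dots> \<le> \<rho> ^ (fst x + snd x)" using B B0 by (intro power_mono)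
      finally show "norm (\<Sum>\<^sub>\<infinity>y. norm (?f (x, y))) \<le> norm (F $ fst x $ snd x) * \<rho> ^ (fst x + snd x)"
        by (simp add: norm_mult infsum_cmult_right' infsum_nonneg mult_left_mono)
    qed auto
  qed
  then have "?f summable_on UNIV \<times> UNIV" by (rule abs_summable_summable)
  then obtain S where S: "(?f has_sum S) (UNIV \<times> UNIV)" by (auto simp: summable_on_def)
  then have "((\<lambda>x. F $ fst x $ snd x * (?w ^ fst x * cnj ?w ^ snd x)) has_sum S) UNIV"
  proof (rule has_sum_SigmaD)
    fix x
    show "((\<lambda>y. ?f (x, y)) has_sum F $ fst x $ snd x * (?w ^ fst x * cnj ?w ^ snd x)) UNIV"
      using has_sum_cmult_right[OF series_eval_has_sum[OF mon[of x] z], of "F $ fst x $ snd x"]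
      by (simp add: series_eval_monomial[OF a(1) z])
  qed
  then have "series_eval F ?w = S"
    by (intro series_eval_eqI) (simp add: series_term_def case_prod_unfold mult.assoc)
  moreover have "((\<lambda>(y, x). ?f (x, y)) has_sum S) (UNIV \<times> UNIV)"
    using S by (subst (asm) has_sum_swap)
  then have "(series_term (substitute F a) z has_sum S) UNIV"
  proof (rule has_sum_SigmaD)
    fix y :: "nat \<times> nat"
    obtain m n where y: "y = (m, n)" by fastforce
    let ?K = "{..m + n}"
    have "F $ fst x $ snd x * series_term (?mon x) z y = 0" if "x \<notin> ?K \<times> ?K" for x
    proof -
      have "order_ge (fst x + snd x) (?mon x)"
        by (intro order_ge_mult order_ge_power order_ge_conj a)
      moreover have "m + n < fst x + snd x" using that by (cases x) auto
      ultimately show ?thesis by (simp add: order_ge_def y series_term_def)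
    qed
    then show "((\<lambda>x. case (y, x) of (y, x) \<Rightarrow> ?f (x, y)) has_sum series_term (substitute F a) z y) UNIV"
      by (intro has_sum_finite_neutralI[of "?K \<times> ?K"])
        (auto simp: y series_term_def substitute_nth sum_distrib_right sum.cartesian_product
          case_prod_unfold mult.assoc intro!: sum.cong)
  qed
  then have "series_eval (substitute F a) z = S" by (rule series_eval_eqI)
  ultimately show ?thesis by simp
qed

section \<open>Differentiation\<close>

definition deriv_z :: "series \<Rightarrow> series" where
  "deriv_z a = mk_series (\<lambda>m n. of_nat (Suc m) * a $ Suc m $ n)"

definition deriv_cnj :: "series \<Rightarrow> series" where
  "deriv_cnj a = mk_series (\<lambda>m n. of_nat (Suc n) * a $ m $ Suc n)"

lemma deriv_cnj_conv: "deriv_cnj a = conj_series (deriv_z (conj_series a))"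
  by (rule series_eqI) (simp add: deriv_z_def deriv_cnj_def)

lemma linear_times_power_bound:
  fixes q :: real
  assumes "0 \<le> s" "s < r"
  obtains C where "0 \<le> C" "\<And>k. real (Suc k) * s ^ k \<le> C * r ^ k"
proof -
  have r: "0 < r" using assms by simp
  have "(\<lambda>k. of_nat k * (s / r) ^ k) \<longlonglongrightarrow> 0"
    using assms by (intro powser_times_n_limit_0) auto
  moreover have "(\<lambda>k. (s / r) ^ k) \<longlonglongrightarrow> 0"
    using assms by (intro LIMSEQ_realpow_zero) auto
  ultimately have "(\<lambda>k. real k * (s / r) ^ k + (s / r) ^ k) \<longlonglongrightarrow> 0 + 0"
    by (rule tendsto_add)
  then have "Bseq (\<lambda>k. real k * (s / r) ^ k + (s / r) ^ k)"
    by (intro convergent_imp_Bseq convergentI)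
  then obtain C where C: "0 < C" "\<And>k. norm (real k * (s / r) ^ k + (s / r) ^ k) \<le> C"
    by (auto simp: Bseq_def)
  have "real (Suc k) * s ^ k \<le> C * r ^ k" for k
  proof -
    have "real (Suc k) * (s / r) ^ k \<le> C"
      using C(2)[of k] by (simp add: algebra_simps abs_le_iff)
    then have "real (Suc k) * (s / r) ^ k * r ^ k \<le> C * r ^ k"
      using r by (intro mult_right_mono) auto
    then show ?thesis using r by (simp add: power_divide)
  qed
  then show thesis using C(1) that[of C] by simp
qed

lemma norm_le_deriv_z:
  assumes a: "norm_le r a B" and s: "0 \<le> s" "s < r"
  obtains C where "norm_le s (deriv_z a) C"
proof -
  obtain C where C: "0 \<le> C" "\<And>k. real (Suc k) * s ^ k \<le> C * r ^ k"
    using linear_times_power_bound[OF s] by blast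
  have r: "0 < r" using s by simp
  let ?f = "\<lambda>m n. C / r * (norm (a $ m $ n) * r ^ (m + n))"
  have "norm_le s (deriv_z a) (C / r * B)"
    unfolding norm_le_def
  proof
    fix K
    have "norm (deriv_z a $ m $ n) * s ^ (m + n) \<le> ?f (Suc m) n" for m n
    proof -
      have "real (Suc m) * s ^ (m + n) \<le> real (Suc (m + n)) * s ^ (m + n)"
        using s by (intro mult_right_mono) auto
      also have "\<dots> \<le> C * r ^ (m + n)" by (rule C(2))
      finally have "norm (a $ Suc m $ n) * (real (Suc m) * s ^ (m + n)) \<le> norm (a $ Suc m $ n) * (C * r ^ (m + n))"
        by (rule mult_left_mono) simp
      moreover have "norm (deriv_z a $ m $ n) * s ^ (m + n) = norm (a $ Suc m $ n) * (real (Suc m) * s ^ (m + n))"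
        by (simp only: deriv_z_def mk_series_nth norm_mult norm_of_nat mult_ac)
      moreover have "?f (Suc m) n = norm (a $ Suc m $ n) * (C * r ^ (m + n))"
        using r by simp
      ultimately show ?thesis by (simp only:)
    qed
    then have "(\<Sum>m\<le>K. \<Sum>n\<le>K. norm (deriv_z a $ m $ n) * s ^ (m + n)) \<le> (\<Sum>m\<le>K. \<Sum>n\<le>K. ?f (Suc m) n)"
      by (intro sum_mono)
    also have "\<dots> \<le> (\<Sum>m\<le>Suc K. \<Sum>n\<le>K. ?f m n)"
      unfolding sum.atMost_Suc_shift using r C(1) by (simp add: sum_nonneg)
    also have "\<dots> \<le> (\<Sum>m\<le>Suc K. \<Sum>n\<le>Suc K. ?f m n)"
      using r C(1) by (intro sum_mono sum_mono2) auto
    also have "\<dots> = C / r * (\<Sum>m\<le>Suc K. \<Sum>n\<le>Suc K. norm (a $ m $ n) * r ^ (m + n))"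
      by (simp only: sum_distrib_left)
    also have "\<dots> \<le> C / r * B"
      using r C(1) by (intro mult_left_mono norm_leD[OF a]) auto
    finally show "(\<Sum>m\<le>K. \<Sum>n\<le>K. norm (deriv_z a $ m $ n) * s ^ (m + n)) \<le> C / r * B" .
  qed
  then show thesis by (rule that)
qed

lemma norm_le_deriv_cnj:
  assumes "norm_le r a B" "0 \<le> s" "s < r"
  obtains C where "norm_le s (deriv_cnj a) C"
  unfolding deriv_cnj_conv
  using norm_le_deriv_z[OF norm_le_conj[OF assms(1)] assms(2,3)] norm_le_conj by metis

lemma has_sum_shift:
  fixes f :: "nat \<times> nat \<Rightarrow> complex"
  assumes "((\<lambda>(m, n). f (Suc m, n)) has_sum S) UNIV" "\<And>n. f (0, n) = 0"
  shows "(f has_sum S) UNIV"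
proof -
  have "inj (\<lambda>(m, n :: nat). (Suc m, n))" by (auto simp: inj_on_def)
  then have "(f has_sum S) (range (\<lambda>(m, n). (Suc m, n)))"
    using assms(1) by (subst has_sum_reindex) (auto simp: o_def case_prod_unfold)
  also have "?this \<longleftrightarrow> (f has_sum S) UNIV"
  proof (rule has_sum_cong_neutral)
    fix x assume "x \<in> UNIV - range (\<lambda>(m, n :: nat). (Suc m, n))"
    then show "f x = 0"
      using assms(2) by (cases x; cases "fst x") (auto simp: image_iff)
  qed auto
  finally show ?thesis .
qed

text \<open>
  The terms of the differentiated series, indexed like the terms of the series itself. The truncated
  exponent \<open>m - 1\<close> is harmless at \<open>m = 0\<close>, where the factor \<open>of_nat m\<close> vanishes.
\<close>

definition term_dz :: "series \<Rightarrow> complex \<Rightarrow> nat \<times> nat \<Rightarrow> complex" where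
  "term_dz a z = (\<lambda>(m, n). of_nat m * a $ m $ n * z ^ (m - 1) * cnj z ^ n)"

definition term_dcnj :: "series \<Rightarrow> complex \<Rightarrow> nat \<times> nat \<Rightarrow> complex" where
  "term_dcnj a z = (\<lambda>(m, n). of_nat n * a $ m $ n * z ^ m * cnj z ^ (n - 1))"

lemma term_dz_has_sum:
  assumes "norm_le r a B" "norm z < r"
  shows "(term_dz a z has_sum series_eval (deriv_z a) z) UNIV"
proof (rule has_sum_shift)
  obtain C where "norm_le (norm z) (deriv_z a) C"
    using norm_le_deriv_z[OF assms(1) norm_ge_zero assms(2)] by blast
  from series_eval_has_sum[OF this order_refl]
  show "((\<lambda>(m, n). term_dz a z (Suc m, n)) has_sum series_eval (deriv_z a) z) UNIV"
    by (simp add: term_dz_def series_term_def deriv_z_def)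
qed (simp add: term_dz_def)

lemma term_dcnj_has_sum:
  assumes "norm_le r a B" "norm z < r"
  shows "(term_dcnj a z has_sum series_eval (deriv_cnj a) z) UNIV"
proof -
  obtain C where "norm_le (norm z) (deriv_cnj a) C"
    using norm_le_deriv_cnj[OF assms(1) norm_ge_zero assms(2)] by blast
  from series_eval_has_sum[OF this order_refl]
  have "(series_term (deriv_cnj a) z has_sum series_eval (deriv_cnj a) z) (UNIV \<times> UNIV)" by simp
  then have "((\<lambda>(n, m). series_term (deriv_cnj a) z (m, n)) has_sum series_eval (deriv_cnj a) z) (UNIV \<times> UNIV)"
    by (subst (asm) has_sum_swap)
  then have "((\<lambda>(n, m). (\<lambda>(n, m). term_dcnj a z (m, n)) (Suc n, m)) has_sum series_eval (deriv_cnj a) z) UNIV"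
    by (simp add: term_dcnj_def series_term_def deriv_cnj_def)
  then have "((\<lambda>(n, m). term_dcnj a z (m, n)) has_sum series_eval (deriv_cnj a) z) UNIV"
    by (rule has_sum_shift) (simp add: term_dcnj_def)
  then have "((\<lambda>(n, m). term_dcnj a z (m, n)) has_sum series_eval (deriv_cnj a) z) (UNIV \<times> UNIV)" by simp
  then show ?thesis by (subst (asm) has_sum_swap) (simp add: case_prod_unfold)
qed

lemma has_sum_imp_sums_prod_decode:
  fixes f :: "nat \<times> nat \<Rightarrow> complex"
  assumes "(f has_sum S) UNIV"
  shows "(\<lambda>i. f (prod_decode i)) sums S"
  using assms has_sum_reindex_bij_betw[OF bij_prod_decode, of f S] by (intro has_sum_imp_sums) simp

lemma sums_tail_le:
  fixes f :: "nat \<Rightarrow> complex"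
  assumes "f sums S" "summable w" "\<And>i. norm (f i) \<le> w i"
  shows "norm (sum f {..<n} - S) \<le> suminf (\<lambda>i. w (i + n))"
proof -
  have tail: "suminf (\<lambda>i. f (i + n)) = S - sum f {..<n}"
    using assms(1) by (intro sums_unique[symmetric]) (simp add: sums_iff_shift)
  have sm: "summable (\<lambda>i. norm (f (i + n)))"
  proof (rule summable_comparison_test')
    show "summable (\<lambda>i. w (i + n))" using assms(2) by (simp only: summable_iff_shift)
    show "norm (norm (f (i + n))) \<le> w (i + n)" if "0 \<le> i" for i using assms(3) by simp
  qed
  have "norm (S - sum f {..<n}) \<le> suminf (\<lambda>i. norm (f (i + n)))"
    unfolding tail[symmetric] using sm by (rule summable_norm)
  also have "\<dots> \<le> suminf (\<lambda>i. w (i + n))"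
    using assms(2) by (intro suminf_le assms(3) sm) (simp only: summable_iff_shift)
  finally show ?thesis by (simp add: norm_minus_commute)
qed

text \<open>
  Termwise differentiation. On a ball of radius \<open>s < r\<close> the differentiated terms are dominated by their
  values at the point \<open>s\<close>, so the series of derivatives converges uniformly.
\<close>

theorem series_eval_has_derivative:
  assumes a: "norm_le r a B" and z: "norm z < r"
  shows "(series_eval a has_derivative
    (\<lambda>h. h * series_eval (deriv_z a) z + cnj h * series_eval (deriv_cnj a) z)) (at z)"
proof -
  obtain s where s: "norm z < s" "s < r" using dense[OF z] by blast
  have s0: "0 < s" using s(1) norm_ge_zero le_less_trans by blast
  let ?f = "\<lambda>i x. series_term a x (prod_decode i)"
  let ?f' = "\<lambda>i x h. h * term_dz a x (prod_decode i) + cnj h * term_dcnj a x (prod_decode i)"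
  let ?g' = "\<lambda>x h. h * series_eval (deriv_z a) x + cnj h * series_eval (deriv_cnj a) x"
  define w where "w i = norm (term_dz a (of_real s) (prod_decode i)) +
      norm (term_dcnj a (of_real s) (prod_decode i))" for i
  have ns: "norm (complex_of_real s) < r" using s s0 by simp
  have "(\<lambda>i. norm (term_dz a (of_real s) i)) summable_on UNIV"
    using term_dz_has_sum[OF a ns] summable_on_iff_abs_summable_on_complex has_sum_imp_summable by blast
  then have 1: "summable (\<lambda>i. norm (term_dz a (of_real s) (prod_decode i)))"
    using summable_on_reindex_bij_betw[OF bij_prod_decode, of "\<lambda>i. norm (term_dz a (of_real s) i)"]
    by (intro summable_on_imp_summable) simp
  have "(\<lambda>i. norm (term_dcnj a (of_real s) i)) summable_on UNIV"
    using term_dcnj_has_sum[OF a ns] summable_on_iff_abs_summable_on_complex has_sum_imp_summable by blast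
  then have 2: "summable (\<lambda>i. norm (term_dcnj a (of_real s) (prod_decode i)))"
    using summable_on_reindex_bij_betw[OF bij_prod_decode, of "\<lambda>i. norm (term_dcnj a (of_real s) i)"]
    by (intro summable_on_imp_summable) simp
  have w: "summable w" unfolding w_def using 1 2 by (rule summable_add)
  have f'_sums: "(\<lambda>i. ?f' i x h) sums ?g' x h" if "norm x < s" for x h
    using that s
    by (intro sums_add sums_mult has_sum_imp_sums_prod_decode term_dz_has_sum[OF a] term_dcnj_has_sum[OF a]) auto
  have f'_le: "norm (?f' i x h) \<le> norm h * w i" if "norm x < s" for i x h
  proof -
    obtain m n where mn: "prod_decode i = (m, n)" by fastforce
    have "norm (term_dz a x (m, n)) \<le> norm (term_dz a (of_real s) (m, n))"
      using that s0 by (auto simp: term_dz_def norm_mult norm_power intro!: mult_mono power_mono)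
    moreover have "norm (term_dcnj a x (m, n)) \<le> norm (term_dcnj a (of_real s) (m, n))"
      using that s0 by (auto simp: term_dcnj_def norm_mult norm_power intro!: mult_mono power_mono)
    ultimately have "norm h * norm (term_dz a x (m, n)) + norm h * norm (term_dcnj a x (m, n)) \<le> norm h * w i"
      by (auto simp: w_def mn intro!: add_mono mult_left_mono simp flip: distrib_left)
    moreover have "norm (?f' i x h) \<le> norm h * norm (term_dz a x (m, n)) + norm h * norm (term_dcnj a x (m, n))"
      by (rule order_trans[OF norm_triangle_ineq]) (simp add: norm_mult mn)
    ultimately show ?thesis by linarith
  qed
  have "\<exists>g. \<forall>x\<in>ball 0 s. (\<lambda>n. ?f n x) sums g x \<and> (g has_derivative ?g' x) (at x within ball 0 s)"
  proof (rule has_derivative_series)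
    show "convex (ball (0::complex) s)" by simp
    show "(?f i has_derivative ?f' i x) (at x within ball 0 s)" for i x
    proof -
      obtain m n where mn: "prod_decode i = (m, n)" by fastforce
      show ?thesis
        unfolding mn series_term_def term_dz_def term_dcnj_def prod.case
        by (auto intro!: derivative_eq_intros bounded_linear.has_derivative[OF bounded_linear_cnj]
            simp: algebra_simps)
    qed
    show "0 \<in> ball (0::complex) s" using s0 by simp
    show "(\<lambda>n. ?f n 0) sums series_eval a 0"
      using s s0 by (intro has_sum_imp_sums_prod_decode series_eval_has_sum[OF a]) auto
    fix e :: real assume e: "0 < e"
    have "(\<lambda>n. suminf (\<lambda>i. w (i + n))) \<longlonglongrightarrow> 0"
      using suminf_exist_split2[OF w] .
    then have "\<forall>\<^sub>F n in sequentially. suminf (\<lambda>i. w (i + n)) < e"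
      using e by (rule order_tendstoD)
    then show "\<forall>\<^sub>F n in sequentially. \<forall>x\<in>ball 0 s. \<forall>h.
        norm ((\<Sum>i<n. ?f' i x h) - ?g' x h) \<le> e * norm h"
    proof eventually_elim
      case (elim n)
      show ?case
      proof (intro ballI allI)
        fix x h :: complex assume "x \<in> ball 0 s"
        then have x: "norm x < s" by simp
        have "norm ((\<Sum>i<n. ?f' i x h) - ?g' x h) \<le> suminf (\<lambda>i. norm h * w (i + n))"
          by (rule sums_tail_le[OF f'_sums[OF x] summable_mult[OF w] f'_le[OF x]])
        also have "\<dots> = norm h * suminf (\<lambda>i. w (i + n))"
          using w by (intro suminf_mult) (simp add: summable_iff_shift)
        also have "\<dots> \<le> norm h * e" using elim by (intro mult_left_mono) auto
        finally show "norm ((\<Sum>i<n. ?f' i x h) - ?g' x h) \<le> e * norm h" by (simp add: mult.commute)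
      qed
    qed
  qed
  then obtain g where g: "\<And>x. x \<in> ball 0 s \<Longrightarrow> (\<lambda>n. ?f n x) sums g x"
    "\<And>x. x \<in> ball 0 s \<Longrightarrow> (g has_derivative ?g' x) (at x within ball 0 s)" by blast
  have "g x = series_eval a x" if "x \<in> ball 0 s" for x
  proof -
    have "(\<lambda>n. ?f n x) sums series_eval a x"
      using that s by (intro has_sum_imp_sums_prod_decode series_eval_has_sum[OF a]) auto
    then show ?thesis using g(1)[OF that] sums_unique2 by blast
  qed
  moreover have zs: "z \<in> ball 0 s" using s by simp
  have "(g has_derivative ?g' z) (at z)"
    using g(2)[OF zs] unfolding at_within_open[OF zs open_ball] .
  ultimately show ?thesis
    using has_derivative_transform_within_open[OF _ open_ball zs] by metis
qed

lemma isCont_series_eval: "norm_le r a B \<Longrightarrow> norm z < r \<Longrightarrow> isCont (series_eval a) z"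
  by (rule has_derivative_continuous[OF series_eval_has_derivative])

lemma series_eval_0: "order_ge 1 a \<Longrightarrow> series_eval a 0 = 0"
proof (rule series_eval_eqI)
  assume "order_ge 1 a"
  then have "series_term a 0 x = 0" for x
    by (cases x) (auto simp: series_term_def order_ge_def power_0_left)
  then show "(series_term a 0 has_sum 0) UNIV" by (intro has_sum_0) auto
qed

text \<open>
  The rotation field \<open>\<i> * z\<close> acts diagonally on monomials, with eigenvalue \<open>\<i> * (m - n)\<close> at
  \<open>z ^ m * cnj z ^ n\<close>.
\<close>

lemma rotation_derivative_has_sum:
  assumes "norm_le r a B" "norm z < r"
  shows "((\<lambda>(m, n). \<i> * (of_nat m - of_nat n) * series_term a z (m, n)) has_sum
    (\<i> * z * series_eval (deriv_z a) z + cnj (\<i> * z) * series_eval (deriv_cnj a) z)) UNIV"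
proof -
  have "((\<lambda>x. \<i> * z * term_dz a z x + cnj (\<i> * z) * term_dcnj a z x) has_sum
    (\<i> * z * series_eval (deriv_z a) z + cnj (\<i> * z) * series_eval (deriv_cnj a) z)) UNIV"
    by (intro has_sum_add has_sum_cmult_right term_dz_has_sum[OF assms] term_dcnj_has_sum[OF assms])
  moreover have "\<i> * z * term_dz a z x + cnj (\<i> * z) * term_dcnj a z x =
      (case x of (m, n) \<Rightarrow> \<i> * (of_nat m - of_nat n) * series_term a z (m, n))" for x
  proof -
    obtain m n where x: "x = (m, n)" by fastforce
    have "of_nat m * (z * z ^ (m - 1)) = of_nat m * z ^ m"
      "of_nat n * (cnj z * cnj z ^ (n - 1)) = of_nat n * cnj z ^ n"
      by (cases m; simp) (cases n; simp)
    moreover have "\<i> * z * term_dz a z x = \<i> * a $ m $ n * (of_nat m * (z * z ^ (m - 1))) * cnj z ^ n"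
      by (simp add: x term_dz_def mult_ac)
    moreover have "cnj (\<i> * z) * term_dcnj a z x = - \<i> * a $ m $ n * z ^ m * (of_nat n * (cnj z * cnj z ^ (n - 1)))"
      by (simp add: x term_dcnj_def mult_ac)
    ultimately show ?thesis by (simp only:) (simp add: x series_term_def algebra_simps)
  qed
  ultimately show ?thesis by (simp only:)
qed

section \<open>The normal form\<close>

definition P_series :: "nat \<Rightarrow> (nat \<times> nat \<Rightarrow> complex) \<Rightarrow> series" where
  "P_series d p = mk_series (\<lambda>m n. if (m, n) \<in> monomials d then p (m, n) else 0)"

text \<open>
  The linear operator \<open>a \<mapsto> Da(\<i> z) - \<i> a\<close> multiplies the coefficient at \<open>(m, n)\<close> by \<open>\<i> * (m - n - 1)\<close>.
  This is its inverse away from the resonances \<open>m = n + 1\<close>, where the operator vanishes; the value 0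
  there normalizes the resonant coefficients of the solution. The numbers are written with rational
  imaginary part as they enter the coefficients of the obstructions.
\<close>

definition homological_inverse :: "nat \<Rightarrow> nat \<Rightarrow> complex" where
  "homological_inverse m n =
    (if m = n + 1 then 0 else Complex 0 (of_rat (- 1 / of_int (int m - int n - 1))))"

text \<open>
  A change of coordinates that carries the rotation to the field up to resonant terms. It is given by the
  inverse of a linearization rather than by the linearization itself: its equation
  \<open>D\<phi>(\<i> z) = \<i> \<phi> + P(\<phi>, cnj \<phi>)\<close> has no derivative in the nonlinear part, which is why the plain fixed point
  argument gives convergence.
\<close>

definition normalization :: "nat \<Rightarrow> (nat \<times> nat \<Rightarrow> complex) \<Rightarrow> series" where
  "normalization d p = solution homological_inverse (P_series d p)"

definition obstruction :: "nat \<Rightarrow> (nat \<times> nat \<Rightarrow> complex) \<Rightarrow> nat \<Rightarrow> complex" where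
  "obstruction d p k = substitute (P_series d p) (normalization d p) $ Suc k $ k"

lemma order_ge_P_series: "order_ge 2 (P_series d p)"
  by (auto simp: order_ge_def P_series_def monomials_def)

lemma P_series_term_has_sum: "(series_term (P_series d p) z has_sum P_poly d p z (cnj z)) UNIV"
  by (rule has_sum_finite_neutralI[OF finite_monomials[of d]])
    (auto simp: series_term_def P_series_def P_poly_def intro!: sum.cong)

lemma series_eval_P_series: "series_eval (P_series d p) z = P_poly d p z (cnj z)"
  by (rule series_eval_eqI[OF P_series_term_has_sum])

lemma norm_le_P_series: "norm_le 1 (P_series d p) (\<Sum>m\<in>monomials d. norm (p m))"
  unfolding norm_le_def
proof
  fix K
  have "(\<Sum>m\<le>K. \<Sum>n\<le>K. norm (P_series d p $ m $ n) * 1 ^ (m + n)) =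
      (\<Sum>x\<in>{..K} \<times> {..K}. if x \<in> monomials d then norm (p x) else 0)"
    by (simp add: sum.cartesian_product case_prod_unfold P_series_def if_distrib[of norm] cong: if_cong)
  also have "\<dots> = (\<Sum>x\<in>({..K} \<times> {..K}) \<inter> monomials d. norm (p x))"
    by (simp add: sum.inter_restrict)
  also have "\<dots> \<le> (\<Sum>m\<in>monomials d. norm (p m))"
    by (intro sum_mono2) (auto simp: finite_monomials)
  finally show "(\<Sum>m\<le>K. \<Sum>n\<le>K. norm (P_series d p $ m $ n) * 1 ^ (m + n)) \<le> (\<Sum>m\<in>monomials d. norm (p m))" .
qed

lemma homological_inverse_mult:
  "m \<noteq> n + 1 \<Longrightarrow> \<i> * (of_nat m - of_nat n - 1) * homological_inverse m n = 1"
proof -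
  assume "m \<noteq> n + 1"
  then have "real m - real n - 1 \<noteq> 0" by linarith
  then show ?thesis
    using \<open>m \<noteq> n + 1\<close> by (simp add: homological_inverse_def complex_eq_iff of_rat_divide of_rat_minus of_rat_diff)
qed

lemma norm_homological_inverse_le: "norm (homological_inverse m n) \<le> 1"
proof (cases "m = n + 1")
  case False
  have "\<i> * (of_nat m - of_nat n - 1) = \<i> * of_int (int m - int n - 1)" by simp
  then have "norm (\<i> * (of_nat m - of_nat n - 1)) = of_int \<bar>int m - int n - 1\<bar>"
    by (simp only: norm_mult norm_ii norm_of_int mult_1 of_int_abs)
  also have "\<dots> \<ge> (1 :: real)" using False by linarith
  finally have "1 * norm (homological_inverse m n) \<le>
      norm (\<i> * (of_nat m - of_nat n - 1)) * norm (homological_inverse m n)"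
    by (intro mult_right_mono) auto
  also have "\<dots> = 1"
    unfolding norm_mult[symmetric] homological_inverse_mult[OF False] by simp
  finally show ?thesis by simp
qed (simp add: homological_inverse_def)

lemma order_ge_normalization: "order_ge 1 (normalization d p)"
  unfolding normalization_def by (intro order_ge_solution order_ge_P_series)

lemma normalization_eq:
  "normalization d p = fps_X + scale_coeffs homological_inverse (substitute (P_series d p) (normalization d p))"
  unfolding normalization_def by (rule solution_eq[OF order_ge_P_series])

lemma obstruction_0: "obstruction d p 0 = 0"
  using order_ge_substitute[OF order_ge_normalization order_ge_P_series]
  by (simp add: obstruction_def order_ge_def)

definition resonant_series :: "nat \<Rightarrow> (nat \<times> nat \<Rightarrow> complex) \<Rightarrow> series" where
  "resonant_series d p = mk_series (\<lambda>m n. if m = Suc n then obstruction d p n else 0)"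

lemma homological_equation:
  "\<i> * (of_nat m - of_nat n) * normalization d p $ m $ n =
    \<i> * normalization d p $ m $ n + substitute (P_series d p) (normalization d p) $ m $ n
      - resonant_series d p $ m $ n"
proof -
  let ?a = "normalization d p" and ?S = "substitute (P_series d p) (normalization d p)"
  have a: "?a $ m $ n = (fps_X :: series) $ m $ n + homological_inverse m n * ?S $ m $ n"
    by (subst normalization_eq) simp
  show ?thesis
  proof (cases "m = n + 1")
    case True
    then show ?thesis by (simp add: resonant_series_def obstruction_def algebra_simps)
  next
    case False
    then have "?a $ m $ n = homological_inverse m n * ?S $ m $ n"
      using a by (simp add: series_X_nth)
    then have "\<i> * (of_nat m - of_nat n - 1) * ?a $ m $ n =
        (\<i> * (of_nat m - of_nat n - 1) * homological_inverse m n) * ?S $ m $ n"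
      by simp
    also have "\<dots> = ?S $ m $ n" unfolding homological_inverse_mult[OF False] by simp
    finally show ?thesis using False by (simp add: resonant_series_def algebra_simps)
  qed
qed

lemma normalization_converges:
  obtains r B C where "0 < r" "norm_le r (normalization d p) B" "B \<le> 1"
    "norm_le r (resonant_series d p) C"
proof -
  obtain r where r: "0 < r" "2 * r \<le> 1" "norm_le r (normalization d p) (2 * r)"
    unfolding normalization_def
    by (rule norm_le_solution[OF order_ge_P_series norm_le_P_series zero_less_one norm_homological_inverse_le])
  have "norm_le r (substitute (P_series d p) (normalization d p)) ((\<Sum>m\<in>monomials d. norm (p m)) * (2 * r / 1)\<^sup>2)"
    using r by (intro norm_le_substitute norm_le_P_series order_ge_P_series) auto
  then have "norm_le r (resonant_series d p) ((\<Sum>m\<in>monomials d. norm (p m)) * (2 * r / 1)\<^sup>2)"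
    using r by (elim norm_le_coeffs) (auto simp: resonant_series_def obstruction_def)
  then show thesis using that[OF r(1,3,2)] by blast
qed

text \<open>
  The homological equation summed up: the image of the circular motion under the normalization follows the
  field up to the resonant terms.
\<close>

lemma normalization_flow:
  assumes a: "norm_le r (normalization d p) B" "B \<le> 1" "norm_le r (resonant_series d p) C"
    and z: "norm z < r"
  shows "\<i> * z * series_eval (deriv_z (normalization d p)) z
      + cnj (\<i> * z) * series_eval (deriv_cnj (normalization d p)) z =
    plane_vfield d p (series_eval (normalization d p) z) - series_eval (resonant_series d p) z"
proof -
  let ?a = "normalization d p" and ?S = "substitute (P_series d p) (normalization d p)"
  have r: "0 \<le> r" using z norm_ge_zero less_eq_real_def order_le_less_trans by metis
  have zr: "norm z \<le> r" using z by simp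
  have "norm_le r ?S ((\<Sum>m\<in>monomials d. norm (p m)) * (B / 1)\<^sup>2)"
    using r a by (intro norm_le_substitute norm_le_P_series order_ge_P_series) auto
  from series_eval_has_sum[OF this zr]
  have S: "(series_term ?S z has_sum P_poly d p (series_eval ?a z) (cnj (series_eval ?a z))) UNIV"
    by (simp add: series_eval_substitute[OF norm_le_P_series a(1) order_ge_normalization a(2) zr]
        series_eval_P_series)
  have "((\<lambda>x. \<i> * series_term ?a z x + series_term ?S z x - series_term (resonant_series d p) z x) has_sum
      (\<i> * series_eval ?a z + P_poly d p (series_eval ?a z) (cnj (series_eval ?a z)) - series_eval (resonant_series d p) z)) UNIV"
    unfolding diff_conv_add_uminus
    by (intro has_sum_add has_sum_cmult_right S series_eval_has_sum[OF a(1) zr]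
        iffD2[OF has_sum_uminus] series_eval_has_sum[OF a(3) zr]) (simp add: series_eval_has_sum[OF a(3) zr])
  moreover have "\<i> * series_term ?a z x + series_term ?S z x - series_term (resonant_series d p) z x =
      (case x of (m, n) \<Rightarrow> \<i> * (of_nat m - of_nat n) * series_term ?a z (m, n))" for x
  proof -
    obtain m n where x: "x = (m, n)" by fastforce
    have "(\<i> * (of_nat m - of_nat n) * ?a $ m $ n) * (z ^ m * cnj z ^ n) =
        (\<i> * ?a $ m $ n + ?S $ m $ n - resonant_series d p $ m $ n) * (z ^ m * cnj z ^ n)"
      by (simp only: homological_equation)
    then show ?thesis by (simp add: x series_term_def algebra_simps)
  qed
  ultimately have "((\<lambda>(m, n). \<i> * (of_nat m - of_nat n) * series_term ?a z (m, n)) has_sum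
      (\<i> * series_eval ?a z + P_poly d p (series_eval ?a z) (cnj (series_eval ?a z)) - series_eval (resonant_series d p) z)) UNIV"
    by (simp only:)
  from has_sum_unique[OF rotation_derivative_has_sum[OF a(1) z] this]
  show ?thesis by (simp add: plane_vfield_def vfield_def)
qed

section \<open>Vanishing obstructions give a linearization\<close>

text \<open>
  Without resonant terms the normalization \<open>\<phi>\<close> satisfies \<open>D\<phi>(\<i> w) = V(\<phi> w)\<close>, so its inverse
  linearizes the field. Writing \<open>\<phi>(w) = w + F(w, cnj w)\<close>, the inverse is the solution of
  \<open>h = z - F(h, cnj h)\<close>, which is analytic by the same fixed point theorem.
\<close>

lemma linearizable_if_no_obstruction:
  assumes "\<And>k. obstruction d p k = 0"
  shows "linearizable (plane_vfield d p)"
proof -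
  let ?a = "normalization d p" and ?V = "plane_vfield d p"
  obtain r B C where r: "0 < r" "norm_le r ?a B" "B \<le> 1" "norm_le r (resonant_series d p) C"
    by (rule normalization_converges)
  have "resonant_series d p = 0"
    by (rule series_eqI) (simp add: resonant_series_def assms)
  then have res: "series_eval (resonant_series d p) z = 0" for z
    by (intro series_eval_eqI has_sum_0) (auto simp: series_term_def)
  define F where "F = scale_coeffs homological_inverse (substitute (P_series d p) ?a)"
  have a_eq: "?a = fps_X + F" unfolding F_def by (rule normalization_eq)
  have F2: "order_ge 2 F"
    unfolding F_def by (intro order_ge_scale order_ge_substitute order_ge_normalization order_ge_P_series)
  have "norm (F $ m $ n) \<le> norm (?a $ m $ n)" for m n
    using F2 by (cases "m = 1 \<and> n = 0") (auto simp: a_eq series_X_nth order_ge_def)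
  then have F: "norm_le r F B" using norm_le_coeffs[OF r(2)] r(1) by simp
  define b where "b = solution (\<lambda>_ _. - 1) F"
  obtain s where s: "0 < s" "2 * s \<le> r" "norm_le s b (2 * s)"
    using norm_le_solution[OF F2 F r(1), of "\<lambda>_ _. - 1"] unfolding b_def by auto
  have b1: "order_ge 1 b" unfolding b_def by (rule order_ge_solution[OF F2])
  have b_eq: "b + substitute F b = fps_X"
    using solution_eq[OF F2, of "\<lambda>_ _. - 1"] unfolding b_def[symmetric]
    by (intro series_eqI) (auto simp: fps_eq_iff dest!: spec)
  let ?h = "series_eval b" and ?\<phi> = "series_eval ?a"
  have inverse: "?\<phi> (?h z) = z" if z: "norm z \<le> s" for z
  proof -
    have hz: "norm (?h z) \<le> r" using norm_series_eval_le[OF s(3) z] s(2) by simp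
    have "norm_le s (substitute F b) (B * (2 * s / r)\<^sup>2)"
      using s r by (intro norm_le_substitute[OF F F2]) auto
    then have "z = ?h z + series_eval (substitute F b) z"
      using series_eval_add[OF s(3) _ z, of "substitute F b"] by (simp add: b_eq series_eval_X)
    also have "series_eval (substitute F b) z = series_eval F (?h z)"
      by (rule series_eval_substitute[OF F s(3) b1 s(2) z])
    also have "?h z + series_eval F (?h z) = ?\<phi> (?h z)"
      unfolding a_eq
      using series_eval_add[OF norm_le_X F hz] r(1) by (simp add: series_eval_X)
    finally show ?thesis by simp
  qed
  let ?D\<phi> = "\<lambda>w v. v * series_eval (deriv_z ?a) w + cnj v * series_eval (deriv_cnj ?a) w"
  let ?Dh = "\<lambda>z v. v * series_eval (deriv_z b) z + cnj v * series_eval (deriv_cnj b) z"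
  have D\<phi>: "(?\<phi> has_derivative ?D\<phi> w) (at w)" if "norm w < r" for w
    by (rule series_eval_has_derivative[OF r(2) that])
  have Dh: "(?h has_derivative ?Dh z) (at z)" if "norm z < s" for z
    by (rule series_eval_has_derivative[OF s(3) that])
  have fd: "frechet_derivative ?h (at z) = ?Dh z" if "norm z < s" for z
    by (rule frechet_derivative_at[OF Dh[OF that], symmetric])
  have comp: "?D\<phi> (?h z) \<circ> ?Dh z = id \<and> ?Dh z \<circ> ?D\<phi> (?h z) = id"
    if z: "norm z < s" and hz: "norm (?h z) < r" for z
  proof -
    have "(?\<phi> \<circ> ?h has_derivative ?D\<phi> (?h z) \<circ> ?Dh z) (at z)"
      by (rule diff_chain_at[OF Dh[OF z] D\<phi>[OF hz]])
    then have "((\<lambda>x. x) has_derivative ?D\<phi> (?h z) \<circ> ?Dh z) (at z)"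
      by (rule has_derivative_transform_within_open[of _ _ _ _ "ball 0 s"])
        (use z inverse in auto)
    then have *: "?D\<phi> (?h z) \<circ> ?Dh z = id"
      using has_derivative_unique has_derivative_ident unfolding id_def by blast
    moreover have "linear (?D\<phi> (?h z))" "linear (?Dh z)"
      using has_derivative_linear[OF D\<phi>[OF hz]] has_derivative_linear[OF Dh[OF z]] .
    ultimately show ?thesis using linear_inverse_left by blast
  qed
  have h0: "?h 0 = 0" by (rule series_eval_0[OF b1])
  show ?thesis
    unfolding linearizable_def
  proof (intro exI[of _ ?h] conjI)
    show "real_analytic_at ?h 0"
      unfolding real_analytic_at_def
    proof (intro exI[of _ "\<lambda>(m, n). b $ m $ n"] exI[of _ s] conjI ballI)
      fix z assume "z \<in> ball (0::complex) s"
      then have "(series_term b z has_sum ?h z) UNIV"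
        by (intro series_eval_has_sum[OF s(3)]) simp
      then show "((\<lambda>(m, n). (case (m, n) of (m, n) \<Rightarrow> b $ m $ n) * (z - 0) ^ m * cnj (z - 0) ^ n) has_sum ?h z) UNIV"
        by (simp add: series_term_def)
    qed (rule s(1))
    show "?h 0 = 0" by (rule h0)
    show "bij (frechet_derivative ?h (at 0))"
      using comp[of 0] s(1) r(1) h0 fd[of 0] o_bij[of "?D\<phi> (?h 0)" "?Dh 0"] by simp
    have "isCont ?h 0" using s by (intro isCont_series_eval[OF s(3)]) simp
    then have "(?h \<longlongrightarrow> 0) (nhds 0)" by (simp add: continuous_at_imp_continuous_at_within isCont_def h0 tendsto_nhds_iff)
    then have "\<forall>\<^sub>F z in nhds 0. norm (?h z) < r"
      using r(1) by (intro order_tendstoD(2)[where y = "0::real"] tendsto_norm_zero)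
    moreover have "\<forall>\<^sub>F z in nhds (0::complex). norm z < s"
      using s(1) by (auto simp: eventually_nhds_metric dist_norm)
    ultimately show "\<forall>\<^sub>F z in nhds 0. frechet_derivative ?h (at z) (?V z) = frechet_derivative ?V (at 0) (?h z)"
    proof eventually_elim
      case (elim z)
      have "?D\<phi> (?h z) (\<i> * ?h z) = ?V (?\<phi> (?h z))"
        using normalization_flow[OF r(2-4) elim(1)] by (simp add: res)
      also have "?\<phi> (?h z) = z" using elim(2) by (intro inverse) simp
      finally have "?Dh z (?V z) = (?Dh z \<circ> ?D\<phi> (?h z)) (\<i> * ?h z)" by simp
      also have "\<dots> = \<i> * ?h z" using comp[OF elim(2,1)] by simp
      finally show ?case
        unfolding fd[OF elim(2)] linear_part_plane_vfield .
    qed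
  qed
qed

section \<open>A linearization forces the obstructions to vanish\<close>

text \<open>
  The resonant monomials are \<open>z * (z * cnj z) ^ k\<close>, so the resonant terms add up to \<open>z\<close> times a power series
  in the squared radius.
\<close>

lemma resonant_series_eval:
  assumes r: "0 < r" and res: "norm_le r (resonant_series d p) C"
  obtains \<rho> where "\<And>x. norm x < r\<^sup>2 \<Longrightarrow> (\<lambda>k. obstruction d p k * x ^ k) sums \<rho> x"
    "\<And>z. norm z < r \<Longrightarrow> series_eval (resonant_series d p) z = z * \<rho> (z * cnj z)"
proof -
  let ?R = "resonant_series d p"
  define \<rho> where "\<rho> x = suminf (\<lambda>k. obstruction d p k * x ^ k)" for x
  have diag: "((\<lambda>k. obstruction d p k * z ^ Suc k * cnj z ^ k) has_sum series_eval ?R z) UNIV"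
    if "norm z \<le> r" for z
  proof -
    have "(series_term ?R z has_sum series_eval ?R z) UNIV"
      by (rule series_eval_has_sum[OF res that])
    also have "?this \<longleftrightarrow> (series_term ?R z has_sum series_eval ?R z) (range (\<lambda>k. (Suc k, k)))"
      by (rule has_sum_cong_neutral) (auto simp: series_term_def resonant_series_def)
    also have "\<dots> \<longleftrightarrow> ((series_term ?R z \<circ> (\<lambda>k. (Suc k, k))) has_sum series_eval ?R z) UNIV"
      by (rule has_sum_reindex) (simp add: inj_on_def)
    finally show ?thesis by (simp add: o_def series_term_def resonant_series_def)
  qed
  have sums: "(\<lambda>k. obstruction d p k * x ^ k) sums \<rho> x" if x: "norm x < r\<^sup>2" for x
  proof -
    have "summable (\<lambda>k. obstruction d p k * of_real r ^ Suc k * cnj (of_real r) ^ k)"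
      using has_sum_imp_sums[OF diag[of "of_real r"]] r by (auto dest: sums_summable)
    then have "summable (\<lambda>k. (1 / of_real r) * (obstruction d p k * of_real r ^ Suc k * cnj (of_real r) ^ k))"
      by (rule summable_mult)
    also have "(\<lambda>k. (1 / of_real r) * (obstruction d p k * of_real r ^ Suc k * cnj (of_real r) ^ k)) =
        (\<lambda>k. obstruction d p k * of_real (r\<^sup>2) ^ k)"
      using r by (simp add: fun_eq_iff power_mult_distrib power2_eq_square)
    finally have "summable (\<lambda>k. obstruction d p k * x ^ k)"
      using x r by (elim powser_inside) (simp add: norm_power)
    then show ?thesis unfolding \<rho>_def by (rule summable_sums)
  qed
  moreover have "series_eval ?R z = z * \<rho> (z * cnj z)" if z: "norm z < r" for z
  proof -
    have "norm (z * cnj z) < r\<^sup>2"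
      using z by (simp add: norm_mult power2_eq_square mult_strict_mono')
    then have "(\<lambda>k. z * (obstruction d p k * (z * cnj z) ^ k)) sums (z * \<rho> (z * cnj z))"
      by (intro sums_mult sums)
    moreover have "(\<lambda>k. z * (obstruction d p k * (z * cnj z) ^ k)) sums series_eval ?R z"
      using has_sum_imp_sums[OF diag[of z]] z by (simp add: power_mult_distrib mult_ac)
    ultimately show ?thesis by (rule sums_unique2[symmetric])
  qed
  ultimately show thesis by (rule that)
qed

lemma real_analytic_at_0_series:
  assumes "real_analytic_at h 0"
  obtains r a B where "0 < r" "norm_le r a B" "\<And>z. norm z \<le> r \<Longrightarrow> h z = series_eval a z"
proof -
  obtain c r where c: "0 < r" "\<And>z. z \<in> ball 0 r \<Longrightarrow>
      ((\<lambda>(m, n). c (m, n) * (z - 0) ^ m * cnj (z - 0) ^ n) has_sum h z) UNIV"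
    using assms unfolding real_analytic_at_def by blast
  define a where "a = mk_series (\<lambda>m n. c (m, n))"
  have ev: "(series_term a z has_sum h z) UNIV" if "norm z < r" for z
    using c(2)[of z] that by (simp add: series_term_def a_def)
  define s where "s = r / 2"
  have s: "0 < s" "s < r" using c(1) by (auto simp: s_def)
  have "(\<lambda>x. norm (series_term a (of_real s) x)) summable_on UNIV"
    using ev[of "of_real s"] s summable_on_iff_abs_summable_on_complex has_sum_imp_summable by fastforce
  then have "norm_le s a (infsum (\<lambda>x. norm (series_term a (of_real s) x)) UNIV)"
    unfolding norm_le_def
  proof (intro allI)
    fix K
    have "(\<Sum>m\<le>K. \<Sum>n\<le>K. norm (a $ m $ n) * s ^ (m + n)) =
        (\<Sum>x\<in>{..K} \<times> {..K}. norm (series_term a (of_real s) x))"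
      using s(1) by (simp add: sum.cartesian_product case_prod_unfold series_term_def norm_mult norm_power power_add mult.assoc)
    also have "\<dots> \<le> infsum (\<lambda>x. norm (series_term a (of_real s) x)) UNIV"
      using \<open>(\<lambda>x. norm (series_term a (of_real s) x)) summable_on UNIV\<close>
      by (intro finite_sum_le_infsum) auto
    finally show "(\<Sum>m\<le>K. \<Sum>n\<le>K. norm (a $ m $ n) * s ^ (m + n)) \<le> infsum (\<lambda>x. norm (series_term a (of_real s) x)) UNIV" .
  qed
  moreover have "h z = series_eval a z" if "norm z \<le> s" for z
    using series_eval_eqI[OF ev[of z]] that s by simp
  ultimately show thesis using that s(1) by blast
qed

text \<open>
  Differentiating the linearization equation at the origin shows that the derivative of the linearization
  commutes with multiplication by \<open>\<i>\<close>; being bijective, it is then multiplication by a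
  nonzero number.
\<close>

lemma linearization_derivative_complex_linear:
  assumes a: "norm_le r a B" "0 < r" "order_ge 1 a"
    and bij: "bij (\<lambda>v. v * series_eval (deriv_z a) 0 + cnj v * series_eval (deriv_cnj a) 0)"
    and eq: "\<forall>\<^sub>F z in nhds 0. plane_vfield d p z * series_eval (deriv_z a) z
        + cnj (plane_vfield d p z) * series_eval (deriv_cnj a) z = \<i> * series_eval a z"
  shows "series_eval (deriv_z a) 0 \<noteq> 0" "series_eval (deriv_cnj a) 0 = 0"
proof -
  let ?V = "plane_vfield d p" and ?\<alpha> = "series_eval (deriv_z a)" and ?\<beta> = "series_eval (deriv_cnj a)"
  let ?L = "\<lambda>z. ?V z * ?\<alpha> z + cnj (?V z) * ?\<beta> z - \<i> * series_eval a z"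
  have r2: "0 \<le> r / 2" "r / 2 < r" using a(2) by auto
  obtain C where "norm_le (r / 2) (deriv_z a) C" using norm_le_deriv_z[OF a(1) r2] .
  from series_eval_has_derivative[OF this, of 0] a(2)
  obtain \<alpha>' where \<alpha>: "(?\<alpha> has_derivative \<alpha>') (at 0)" by auto
  obtain C where "norm_le (r / 2) (deriv_cnj a) C" using norm_le_deriv_cnj[OF a(1) r2] .
  from series_eval_has_derivative[OF this, of 0] a(2)
  obtain \<beta>' where \<beta>: "(?\<beta> has_derivative \<beta>') (at 0)" by auto
  have h: "(series_eval a has_derivative (\<lambda>v. v * ?\<alpha> 0 + cnj v * ?\<beta> 0)) (at 0)"
    using series_eval_has_derivative[OF a(1), of 0] a(2) by simp
  have V: "(?V has_derivative (\<lambda>v. \<i> * v)) (at 0)"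
  proof -
    have "((\<lambda>z. \<i> * z + P_poly d p z (cnj z)) has_derivative (\<lambda>v. \<i> * v + 0)) (at 0)"
      by (intro has_derivative_add P_poly_has_derivative_0) (auto intro!: derivative_eq_intros)
    then show ?thesis by (simp add: plane_vfield_def[abs_def] vfield_def)
  qed
  have V0: "?V 0 = 0"
    using series_eval_0[of "P_series d p"] order_ge_mono[OF order_ge_P_series, of 1 d p]
    by (simp add: plane_vfield_def vfield_def series_eval_P_series)
  have cV: "((\<lambda>z. cnj (?V z)) has_derivative (\<lambda>v. cnj (\<i> * v))) (at 0)"
    by (rule bounded_linear.has_derivative[OF bounded_linear_cnj V])
  have "(?L has_derivative (\<lambda>v. (?V 0 * \<alpha>' v + \<i> * v * ?\<alpha> 0) + (cnj (?V 0) * \<beta>' v + cnj (\<i> * v) * ?\<beta> 0)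
      - \<i> * (v * ?\<alpha> 0 + cnj v * ?\<beta> 0))) (at 0)"
    by (intro has_derivative_diff has_derivative_add has_derivative_mult V cV \<alpha> \<beta>
        has_derivative_mult_right h)
  moreover have "(?L has_derivative (\<lambda>_. 0)) (at 0)"
  proof (rule has_derivative_transform_eventually)
    show "((\<lambda>_. 0) has_derivative (\<lambda>_. 0 :: complex)) (at (0 :: complex))" by simp
    have ev0: "\<forall>\<^sub>F z in nhds 0. 0 = ?L z" using eq by eventually_elim simp
    then show "\<forall>\<^sub>F z in at 0. 0 = ?L z" by (simp add: eventually_at_filter eventually_mono)
    show "0 = ?L 0" using eventually_nhds_x_imp_x[OF ev0] .
  qed simp
  ultimately have "(\<lambda>v. (?V 0 * \<alpha>' v + \<i> * v * ?\<alpha> 0) + (cnj (?V 0) * \<beta>' v + cnj (\<i> * v) * ?\<beta> 0)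
      - \<i> * (v * ?\<alpha> 0 + cnj v * ?\<beta> 0)) = (\<lambda>_. 0)"
    by (rule has_derivative_unique)
  from fun_cong[OF this, of 1] show \<beta>0: "?\<beta> 0 = 0" by (simp add: V0 algebra_simps)
  show "?\<alpha> 0 \<noteq> 0"
  proof
    assume "?\<alpha> 0 = 0"
    then have "inj (\<lambda>_ :: complex. 0 :: complex)" using bij_is_inj[OF bij] \<beta>0 by simp
    then show False using injD[of "\<lambda>_ :: complex. 0 :: complex" 0 1] by simp
  qed
qed

text \<open>
  Let \<open>h\<close> be a linearization, \<open>c\<close> its complex derivative at 0 and \<open>\<phi>\<close> the normalization. On the
  circle \<open>u \<theta> = t * cis \<theta>\<close> put \<open>g = \<rho> (t\<^sup>2)\<close>. If \<open>g \<noteq> 0\<close>, the function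
  \<open>E \<theta> = cis (- \<theta>) * h (\<phi> (u \<theta>)) / (c * t * g)\<close> is periodic. In its derivative the contribution of the field cancels
  against that of the factor \<open>cis (- \<theta>)\<close>, and what remains comes from the resonant terms: it is
  close to \<open>- 1\<close> for small \<open>t\<close>. So the real part of \<open>E\<close> is strictly decreasing, a contradiction. Hence
  \<open>\<rho>\<close> vanishes on an interval and all its coefficients are 0.
\<close>

lemma no_obstruction_if_linearizable:
  assumes "linearizable (plane_vfield d p)"
  shows "obstruction d p k = 0"
proof -
  let ?a = "normalization d p" and ?V = "plane_vfield d p"
  obtain h where h: "real_analytic_at h 0" "h 0 = 0" "bij (frechet_derivative h (at 0))"
    "\<forall>\<^sub>F z in nhds 0. frechet_derivative h (at z) (?V z) = frechet_derivative ?V (at 0) (h z)"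
    using assms unfolding linearizable_def by blast
  obtain s b A where b: "0 < s" "norm_le s b A" "\<And>z. norm z \<le> s \<Longrightarrow> h z = series_eval b z"
    using real_analytic_at_0_series[OF h(1)] by blast
  let ?h = "series_eval b" and ?\<phi> = "series_eval ?a"
  let ?\<alpha> = "series_eval (deriv_z b)" and ?\<beta> = "series_eval (deriv_cnj b)"
  let ?Dh = "\<lambda>z v. v * ?\<alpha> z + cnj v * ?\<beta> z"
  have Dh: "(?h has_derivative ?Dh z) (at z)" if "norm z < s" for z
    by (rule series_eval_has_derivative[OF b(2) that])
  have fd: "frechet_derivative h (at z) = ?Dh z" if z: "norm z < s" for z
  proof -
    have "(h has_derivative ?Dh z) (at z)"
      by (rule has_derivative_transform_within_open[OF Dh[OF z], of "ball 0 s"]) (use z b(3) in auto)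
    from frechet_derivative_at[OF this] show ?thesis by simp
  qed
  have near: "\<forall>\<^sub>F z in nhds (0::complex). norm z < s"
    using b(1) by (auto simp: eventually_nhds_metric dist_norm)
  have eq: "\<forall>\<^sub>F z in nhds 0. ?Dh z (?V z) = \<i> * ?h z"
    using h(4) near by eventually_elim (simp add: fd b(3) linear_part_plane_vfield)
  have b1: "order_ge 1 b"
  proof -
    have "series_eval b 0 = b $ 0 $ 0"
      by (rule series_eval_eqI, rule has_sum_finite_neutralI[of "{(0, 0)}"])
        (auto simp: series_term_def power_0_left split: if_splits)
    then show ?thesis using h(2) b(1) b(3)[of 0] by (auto simp: order_ge_def)
  qed
  have "bij (?Dh 0)" using h(3) fd[of 0] b(1) by simp
  note lin = linearization_derivative_complex_linear[OF b(2,1) b1 this eq]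
  define c where "c = ?\<alpha> 0"
  have c: "c \<noteq> 0" using lin(1) by (simp add: c_def)
  obtain r B C where r: "0 < r" "norm_le r ?a B" "B \<le> 1" "norm_le r (resonant_series d p) C"
    by (rule normalization_converges)
  obtain \<rho> where \<rho>: "\<And>x. norm x < r\<^sup>2 \<Longrightarrow> (\<lambda>k. obstruction d p k * x ^ k) sums \<rho> x"
    "\<And>z. norm z < r \<Longrightarrow> series_eval (resonant_series d p) z = z * \<rho> (z * cnj z)"
    by (rule resonant_series_eval[OF r(1,4)]) blast
  have s2: "0 \<le> s / 2" "s / 2 < s" using b(1) by auto
  have \<alpha>: "isCont ?\<alpha> 0"
  proof -
    obtain C where "norm_le (s / 2) (deriv_z b) C" using norm_le_deriv_z[OF b(2) s2] .
    then show ?thesis by (rule isCont_series_eval) (use b(1) in auto)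
  qed
  have \<beta>: "isCont ?\<beta> 0"
  proof -
    obtain C where "norm_le (s / 2) (deriv_cnj b) C" using norm_le_deriv_cnj[OF b(2) s2] .
    then show ?thesis by (rule isCont_series_eval) (use b(1) in auto)
  qed
  have \<phi>0: "?\<phi> 0 = 0" by (rule series_eval_0[OF order_ge_normalization])
  have \<phi>_lim: "(?\<phi> \<longlongrightarrow> 0) (nhds 0)"
    using isCont_series_eval[OF r(2), of 0] r(1) by (simp add: isCont_def \<phi>0 tendsto_nhds_iff)
  have "(?\<alpha> \<longlongrightarrow> c) (nhds 0)" "(?\<beta> \<longlongrightarrow> 0) (nhds 0)"
    using \<alpha> \<beta> lin(2) by (simp_all add: isCont_def c_def tendsto_nhds_iff)
  then have ev\<alpha>\<beta>: "\<forall>\<^sub>F w in nhds 0. norm (?\<alpha> w - c) < norm c / 4" "\<forall>\<^sub>F w in nhds 0. norm (?\<beta> w) < norm c / 4"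
    using c tendstoD[of ?\<alpha> c "nhds 0" "norm c / 4"] tendstoD[of ?\<beta> 0 "nhds 0" "norm c / 4"]
    by (simp_all add: dist_norm)
  have "\<forall>\<^sub>F w in nhds 0. norm (?\<alpha> w - c) < norm c / 4 \<and> norm (?\<beta> w) < norm c / 4 \<and>
      norm w < s \<and> ?Dh w (?V w) = \<i> * ?h w"
    using ev\<alpha>\<beta> near eq by eventually_elim simp
  from eventually_compose_filterlim[OF this \<phi>_lim]
  have "\<forall>\<^sub>F z in nhds 0. norm (?\<alpha> (?\<phi> z) - c) < norm c / 4 \<and> norm (?\<beta> (?\<phi> z)) < norm c / 4 \<and>
      norm (?\<phi> z) < s \<and> ?Dh (?\<phi> z) (?V (?\<phi> z)) = \<i> * ?h (?\<phi> z)" .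
  then obtain e where e: "0 < e" "\<And>z. norm z < e \<Longrightarrow> norm (?\<alpha> (?\<phi> z) - c) < norm c / 4 \<and>
      norm (?\<beta> (?\<phi> z)) < norm c / 4 \<and> norm (?\<phi> z) < s \<and> ?Dh (?\<phi> z) (?V (?\<phi> z)) = \<i> * ?h (?\<phi> z)"
    unfolding eventually_nhds_metric by (auto simp: dist_norm)
  define q where "q = min e r"
  have \<rho>_zero: "\<rho> (of_real (t\<^sup>2)) = 0" if t: "0 < t" "t < q" for t
  proof (rule ccontr)
    define g where "g = \<rho> (of_real (t\<^sup>2))"
    assume "\<rho> (of_real (t\<^sup>2)) \<noteq> 0"
    then have g: "g \<noteq> 0" by (simp add: g_def)
    define u where "u \<theta> = of_real t * cis \<theta>" for \<theta>
    have nu: "norm (u \<theta>) = t" for \<theta> using t by (simp add: u_def norm_mult)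
    have uu: "u \<theta> * cnj (u \<theta>) = of_real (t\<^sup>2)" for \<theta>
      using nu[of \<theta>] by (simp add: complex_norm_square[symmetric])
    have ue: "norm (u \<theta>) < e" "norm (u \<theta>) < r" for \<theta> using nu t by (auto simp: q_def)
    define m where "m = c * of_real t * g"
    have m: "m \<noteq> 0" using c g t by (simp add: m_def)
    define E where "E \<theta> = cis (- \<theta>) * ?h (?\<phi> (u \<theta>)) / m" for \<theta>
    define E' where "E' \<theta> = - (?\<alpha> (?\<phi> (u \<theta>)) / c + cis (- \<theta>) * cnj (u \<theta> * g) * ?\<beta> (?\<phi> (u \<theta>)) / m)" for \<theta>
    have E_deriv: "(E has_vector_derivative E' \<theta>) (at \<theta>)" for \<theta>
    proof -
      let ?w = "?\<phi> (u \<theta>)" and ?D\<phi> = "\<lambda>v. v * series_eval (deriv_z ?a) (u \<theta>) + cnj v * series_eval (deriv_cnj ?a) (u \<theta>)"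
      have u': "(u has_vector_derivative \<i> * u \<theta>) (at \<theta>)"
        unfolding u_def has_vector_derivative_def
        by (auto intro!: derivative_eq_intros simp: scaleR_conv_of_real mult_ac)
      have "(?\<phi> has_derivative ?D\<phi>) (at (u \<theta>) within range u)"
        by (rule has_derivative_at_withinI[OF series_eval_has_derivative[OF r(2) ue(2)]])
      from vector_derivative_diff_chain_within[OF u' this]
      have \<phi>': "(?\<phi> \<circ> u has_vector_derivative ?V ?w - u \<theta> * g) (at \<theta>)"
        using normalization_flow[OF r(2-4) ue(2)] by (simp add: \<rho>(2)[OF ue(2)] uu g_def)
      have small: "norm ?w < s" "?Dh ?w (?V ?w) = \<i> * ?h ?w" using e(2)[OF ue(1)] by auto
      have "(?h has_derivative ?Dh ?w) (at ((?\<phi> \<circ> u) \<theta>) within range (?\<phi> \<circ> u))"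
        unfolding o_apply by (rule has_derivative_at_withinI[OF Dh[OF small(1)]])
      from vector_derivative_diff_chain_within[OF \<phi>' this]
      have h': "(?h \<circ> (?\<phi> \<circ> u) has_vector_derivative ?Dh ?w (?V ?w - u \<theta> * g)) (at \<theta>)" .
      have cis': "((\<lambda>\<theta>. cis (- \<theta>) / m) has_vector_derivative - \<i> * cis (- \<theta>) / m) (at \<theta>)"
        unfolding has_vector_derivative_def using m
        by (auto intro!: derivative_eq_intros simp: scaleR_conv_of_real mult_ac)
      have "((\<lambda>\<theta>. cis (- \<theta>) / m * (?h \<circ> (?\<phi> \<circ> u)) \<theta>) has_vector_derivative
          cis (- \<theta>) / m * ?Dh ?w (?V ?w - u \<theta> * g) + - \<i> * cis (- \<theta>) / m * (?h \<circ> (?\<phi> \<circ> u)) \<theta>) (at \<theta>)"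
        by (rule has_vector_derivative_mult[OF cis' h'])
      moreover have "(\<lambda>\<theta>. cis (- \<theta>) / m * (?h \<circ> (?\<phi> \<circ> u)) \<theta>) = E"
        by (simp add: E_def fun_eq_iff)
      moreover have "cis (- \<theta>) / m * ?Dh ?w (?V ?w - u \<theta> * g) + - \<i> * cis (- \<theta>) / m * (?h \<circ> (?\<phi> \<circ> u)) \<theta> = E' \<theta>"
      proof -
        have split: "?Dh ?w (?V ?w - u \<theta> * g) = \<i> * ?h ?w - (u \<theta> * g * ?\<alpha> ?w + cnj (u \<theta> * g) * ?\<beta> ?w)"
          unfolding small(2)[symmetric] by (simp add: algebra_simps)
        have "cis (- \<theta>) * u \<theta> = of_real t" by (simp add: u_def cis_mult)
        then have "cis (- \<theta>) * u \<theta> * g * ?\<alpha> ?w / m = ?\<alpha> ?w / c"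
          using c t g by (simp add: m_def)
        then show ?thesis
          unfolding split E'_def by (simp add: diff_divide_distrib add_divide_distrib algebra_simps)
      qed
      ultimately show ?thesis by simp
    qed
    \<comment> \<open>the first summand of \<open>- E' \<theta>\<close> is within 1/4 of 1 and the second within 1/4 of 0\<close>
    have E'_neg: "Re (E' \<theta>) < 0" for \<theta>
    proof -
      have "norm (?\<alpha> (?\<phi> (u \<theta>)) - c) < norm c / 4" "norm (?\<beta> (?\<phi> (u \<theta>))) < norm c / 4"
        using e(2)[OF ue(1)[of \<theta>]] by auto
      then have 1: "norm (?\<alpha> (?\<phi> (u \<theta>)) / c - 1) < 1 / 4"
        using c by (simp add: divide_simps flip: norm_divide norm_mult) (simp add: norm_divide field_simps)
      have "norm (cis (- \<theta>) * cnj (u \<theta> * g) * ?\<beta> (?\<phi> (u \<theta>)) / m) = norm (?\<beta> (?\<phi> (u \<theta>))) / norm c"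
        using g t by (simp add: norm_mult norm_divide nu m_def)
      also have "\<dots> < 1 / 4" using \<open>norm (?\<beta> (?\<phi> (u \<theta>))) < norm c / 4\<close> c by (simp add: field_simps)
      finally have 2: "norm (cis (- \<theta>) * cnj (u \<theta> * g) * ?\<beta> (?\<phi> (u \<theta>)) / m) < 1 / 4" .
      show ?thesis
        using 1 2 abs_Re_le_cmod[of "?\<alpha> (?\<phi> (u \<theta>)) / c - 1"]
          abs_Re_le_cmod[of "cis (- \<theta>) * cnj (u \<theta> * g) * ?\<beta> (?\<phi> (u \<theta>)) / m"]
        unfolding E'_def uminus_complex.simps plus_complex.simps minus_complex.simps one_complex.simps
        by linarith
    qed
    have "Re (E (2 * pi)) < Re (E 0)"
    proof (rule DERIV_neg_imp_decreasing[where f = "\<lambda>\<theta>. Re (E \<theta>)"])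
      fix \<theta> :: real
      have "((\<lambda>\<theta>. Re (E \<theta>)) has_vector_derivative Re (E' \<theta>)) (at \<theta>)"
        by (rule bounded_linear.has_vector_derivative[OF bounded_linear_Re E_deriv])
      then show "\<exists>y. ((\<lambda>\<theta>. Re (E \<theta>)) has_real_derivative y) (at \<theta>) \<and> y < 0"
        using E'_neg has_real_derivative_iff_has_vector_derivative by blast
    qed simp
    moreover have "E (2 * pi) = E 0" by (simp add: E_def u_def cis.ctr complex_eq_iff)
    ultimately show False by simp
  qed
  show "obstruction d p k = 0"
  proof (rule ccontr)
    assume k: "obstruction d p k \<noteq> 0"
    have "k > 0" using k obstruction_0 by (cases k) auto
    moreover have "\<rho> 0 = 0"
      using sums_unique2[OF \<rho>(1)[of 0] powser_sums_zero] r(1) obstruction_0[of d p] by simp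
    ultimately obtain x where x: "0 < x" "\<And>z. z \<in> cball 0 x - {0} \<Longrightarrow> \<rho> z \<noteq> 0"
      using r(1) \<rho>(1)
      by (elim powser_0_nonzero[of "r\<^sup>2" 0 "obstruction d p" \<rho>, OF _ _ _ k, rotated 2]) simp_all
    define t where "t = min (q / 2) (sqrt x)"
    have t: "0 < t" "t < q" using e(1) r(1) x(1) by (auto simp: t_def q_def)
    have "t\<^sup>2 \<le> (sqrt x)\<^sup>2" using t(1) by (intro power_mono) (auto simp: t_def)
    then have "of_real (t\<^sup>2) \<in> cball 0 x - {0 :: complex}" using x(1) t(1) by (auto simp: norm_power)
    then show False using x(2) \<rho>_zero[OF t] by blast
  qed
qed

section \<open>The obstructions are rational polynomials\<close>

definition rational_series :: "'i set \<Rightarrow> (('i \<Rightarrow> complex) \<Rightarrow> series) \<Rightarrow> bool" where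
  "rational_series I a \<longleftrightarrow> (\<forall>m n. rational_in I (\<lambda>p. a p $ m $ n))"

lemma rational_series_mult:
  "rational_series I a \<Longrightarrow> rational_series I b \<Longrightarrow> rational_series I (\<lambda>p. a p * b p)"
  unfolding rational_series_def series_mult_nth
  by (intro allI rational_in_sum rational_in_mult) auto

lemma rational_in_if: "rational_in I (\<lambda>p. if b then 1 else 0)"
  using rational_in_const[of I 1 0] rational_in_zero by (auto simp: one_complex.code)

lemma rational_series_power: "rational_series I a \<Longrightarrow> rational_series I (\<lambda>p. a p ^ k)"
proof (induction k)
  case 0
  then show ?case
    unfolding rational_series_def power_0 series_one_nth by (intro allI rational_in_if)
qed (auto intro: rational_series_mult)

lemma rational_series_substitute:
  assumes "rational_series I F" "rational_series I a"
  shows "rational_series I (\<lambda>p. substitute (F p) (a p))"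
proof -
  have "rational_series I (\<lambda>p. conj_series (a p))"
    using assms(2) by (auto simp: rational_series_def intro: rational_in_cnj)
  then have "rational_series I (\<lambda>p. a p ^ i * conj_series (a p) ^ j)" for i j
    by (intro rational_series_mult rational_series_power assms)
  then show ?thesis
    using assms(1) unfolding rational_series_def substitute_nth
    by (intro allI rational_in_sum rational_in_mult) auto
qed

lemma rational_series_P_series: "rational_series (monomials d) (P_series d)"
proof -
  have "rational_in (monomials d) (\<lambda>p. if (m, n) \<in> monomials d then p (m, n) else 0)" for m n
    by (cases "(m, n) \<in> monomials d") (simp_all add: rational_in_zero rational_in_coord)
  then show ?thesis by (simp add: rational_series_def P_series_def)
qed

text \<open>
  By induction along the iteration, whose coefficients only use ring operations, conjugation and the
  rational numbers in the homological inverse.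
\<close>

lemma rational_series_iterate:
  "rational_series (monomials d) (\<lambda>p. iterate homological_inverse (P_series d p) k)"
proof (induction k)
  case 0
  show ?case unfolding rational_series_def iterate.simps series_X_nth by (intro allI rational_in_if)
next
  case (Suc k)
  have "rational_in (monomials d) (\<lambda>p. homological_inverse m n)" for m n
    using rational_in_const[of _ 0] rational_in_zero by (auto simp: homological_inverse_def)
  moreover have "rational_series (monomials d) (\<lambda>p. fps_X)"
    unfolding rational_series_def series_X_nth by (intro allI rational_in_if)
  moreover have "rational_series (monomials d) (\<lambda>p. scale_coeffs homological_inverse
      (substitute (P_series d p) (iterate homological_inverse (P_series d p) k)))"
    using rational_series_substitute[OF rational_series_P_series Suc] calculation(1)
    by (auto simp: rational_series_def intro!: rational_in_mult)
  ultimately show ?case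
    unfolding rational_series_def iterate.simps fps_add_nth by (intro allI rational_in_add) auto
qed

text \<open>
  An obstruction involves a coefficient of degree \<open>2 * k + 1\<close>, which step \<open>2 * k\<close> of the iteration
  already determines.
\<close>

lemma rational_in_obstruction: "rational_in (monomials d) (\<lambda>p. obstruction d p k)"
  using rational_series_substitute[OF rational_series_P_series rational_series_iterate]
  by (simp add: obstruction_def normalization_def rational_series_def
      substitute_solution_nth[OF order_ge_P_series, of "Suc k" k "2 * k"])

theorem theorem9:
  fixes d :: nat
  assumes "d \<ge> 2"
  shows "affine_variety_over_rat (monomials d) (isochronous_set d)"
proof -
  have "isochronous_set d = {p \<in> cspace (monomials d). \<forall>k. obstruction d p k = 0}"
    unfolding isochronous_set_def
    using linearizable_if_no_obstruction no_obstruction_if_linearizable by blast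
  then show ?thesis
    using affine_variety_of_rational_equations[OF finite_monomials rational_in_obstruction] by simp
qed

end
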